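(* For every integer $d \ge 3$ and every real $p \ge 1$ there exists a centrally symmetric convex body $K \subset \mathbb{R}^d$ such that $$\Delta^p(K) > \theta^p(K).$$
   Context: A convex body is a convex compact set with non-empty interior. $\Delta^p(K) = \mathbb{E}|XX'|^p$, where $X, X'$ are independent and uniformly distributed in $K$ with respect to Lebesgue measure. $\theta^p(K) = \mathbb{E}|YY'|^p$, where $Y, Y'$ are independent and uniformly distributed on $\partial K$ with respect to $(d-1)$-dimensional surface (Hausdorff) measure. $|AB|$ denotes Euclidean distance. (The superscript $p$ denotes the $p$-th moment of the distance, not a power of the mean.) *)

theory Defs
  imports "HOL-Probability.Probability"
begin

definition convex_body :: "'a::euclidean_space set \<Rightarrow> bool" where
  "convex_body K \<longleftrightarrow> convex K \<and> compact K \<and> interior K \<noteq> {}"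

definition centrally_symmetric :: "'a::real_vector set \<Rightarrow> bool" where
  "centrally_symmetric K \<longleftrightarrow> (\<exists>c. (\<lambda>x. 2 *\<^sub>R c - x) ` K = K)"

text \<open>
  Hausdorff measure of integer dimension \<open>k\<close>. Covering sets have to be bounded because
  \<^const>\<open>diameter\<close> has no meaningful value on unbounded sets. Empty covering sets get
  weight 0, which the formula alone would not give for \<open>k = 0\<close>. The factor
  \<open>unit_ball_vol k / 2 ^ k\<close> is the usual normalisation under which the \<open>k\<close>-dimensional
  measure agrees with Lebesgue measure on \<open>k\<close>-dimensional space.
\<close>

definition hausdorff_weight :: "nat \<Rightarrow> 'a::metric_space set \<Rightarrow> ennreal" where
  "hausdorff_weight k U =
     (if U = {} then 0 else ennreal (unit_ball_vol (real k) * (diameter U / 2) ^ k))"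

definition hausdorff_content :: "nat \<Rightarrow> real \<Rightarrow> 'a::metric_space set \<Rightarrow> ennreal" where
  "hausdorff_content k \<delta> A =
     (INF U \<in> {U :: nat \<Rightarrow> 'a set.
                A \<subseteq> (\<Union>i. U i) \<and> (\<forall>i. bounded (U i) \<and> diameter (U i) \<le> \<delta>)}.
        \<Sum>i. hausdorff_weight k (U i))"

definition hausdorff_outer :: "nat \<Rightarrow> 'a::metric_space set \<Rightarrow> ennreal" where
  "hausdorff_outer k A = (SUP \<delta> \<in> {0<..}. hausdorff_content k \<delta> A)"

text \<open>
  \<^const>\<open>hausdorff_outer\<close> is a metric outer measure, hence countably additive on the Borel
  sets by Caratheodory's criterion; so the default value of \<^const>\<open>measure_of\<close> for
  functions that are not measures plays no role here.
\<close>

definition hausdorff_measure :: "nat \<Rightarrow> 'a::metric_space measure" where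
  "hausdorff_measure k = measure_of UNIV (sets borel) (hausdorff_outer k)"

definition distance_moment :: "real \<Rightarrow> 'a::metric_space measure \<Rightarrow> real" where
  "distance_moment p M = (\<integral>(x, y). dist x y powr p \<partial>(M \<Otimes>\<^sub>M M))"

definition interior_moment :: "real \<Rightarrow> 'a::euclidean_space set \<Rightarrow> real" where
  "interior_moment p K = distance_moment p (uniform_measure lborel K)"

definition boundary_moment :: "real \<Rightarrow> 'a::euclidean_space set \<Rightarrow> real" where
  "boundary_moment p K =
     distance_moment p (uniform_measure (hausdorff_measure (DIM('a) - 1)) (frontier K))"

end

theory Submission
  imports Defs
begin

text \<open>
  Fix two coordinates \<open>t\<close> and \<open>y\<close>, let \<open>r\<close> be the Euclidean norm of the remaining ones, and take
  \<open>K = {max (\<bar>t\<bar>) (\<bar>y\<bar> / c) + r / b \<le> 1}\<close> with \<open>c \<lless> b \<lless> 1\<close>, so that distances in \<open>K\<close> are essentially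
  differences of \<open>t\<close>. Up to a fraction of order \<open>c\<close>, the boundary consists of the facets on which
  \<open>\<bar>y\<bar> / c + r / b = 1\<close>. Each of their halves is a cone with apex at \<open>\<bar>t\<bar> = 1\<close>, so
  \<open>\<bar>t\<bar> > s\<close> has probability \<open>(1 - s) ^ (d - 1)\<close> there. The diagonal map that contracts the half of \<open>K\<close>
  towards \<open>t = 1\<close> but keeps \<open>y\<close> has Jacobian \<open>(1 - s) ^ (d - 1)\<close> as well and is not onto
  \<open>K \<inter> {t > s}\<close> when \<open>d \<ge> 3\<close>; hence interior points are strictly more spread out in \<open>t\<close>, by an amount
  that does not depend on \<open>b\<close> and \<open>c\<close>.

  Of the Hausdorff measure only its behaviour under Lipschitz maps is used. If the boundary had
  measure \<open>0\<close> or \<open>\<infinity>\<close>, then the uniform measure on it would be the zero measure and the claim trivial.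
\<close>

section \<open>Moments of symmetric laws and their tails\<close>

lemma convex_on_powr_atLeast_0:
  fixes p :: real
  assumes "1 \<le> p"
  shows "convex_on {0..} (\<lambda>x. x powr p)"
proof (rule convex_onI)
  fix t x y :: real
  assume t: "0 < t" "t < 1" and xy: "x \<in> {0..}" "y \<in> {0..}"
  \<comment> \<open>If one of the two points is 0, convexity comes down to
    \<open>s powr p \<le> s\<close> for a weight \<open>s\<close> strictly between 0 and 1.\<close>
  have le: "s powr p \<le> s" if "0 < s" "s < 1" for s :: real
    using powr_mono'[of 1 p s] that assms by simp
  show "((1 - t) *\<^sub>R x + t *\<^sub>R y) powr p \<le> (1 - t) * x powr p + t * y powr p"
  proof (cases "x = 0 \<or> y = 0")
    case True
    then show ?thesis
      using t xy le[of t] le[of "1 - t"]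
      by (auto simp: powr_mult mult_right_mono)
  next
    case False
    then show ?thesis
      using convex_onD[OF powr_convex[OF assms], of t x y] t xy by auto
  qed
qed auto

text \<open>Write \<open>z powr p = z * z powr (p - 1)\<close> and bound both second factors by
  \<open>(x + y) powr (p - 1)\<close>.\<close>

lemma powr_superadditive:
  fixes x y p :: real
  assumes "0 \<le> x" "0 \<le> y" "1 \<le> p"
  shows "x powr p + y powr p \<le> (x + y) powr p"
proof (cases "x = 0 \<or> y = 0")
  case False
  then have pos: "0 < x" "0 < y" using assms by auto
  have split: "z powr p = z * z powr (p - 1)" if "0 < z" for z :: real
    using that powr_add[of z 1 "p - 1"] by simp
  have "x * x powr (p - 1) + y * y powr (p - 1) \<le> x * (x + y) powr (p - 1) + y * (x + y) powr (p - 1)"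
    using pos assms by (intro add_mono mult_left_mono powr_mono2) auto
  also have "\<dots> = (x + y) powr p"
    using split[of "x + y"] pos by (simp add: distrib_right)
  finally show ?thesis using split pos by simp
qed (use assms in auto)

text \<open>
  Under a symmetric law, \<open>\<bar>a - u\<bar> powr p\<close> may be averaged over \<open>u\<close> and \<open>- u\<close>; unlike
  \<open>\<bar>a - u\<bar> powr p\<close> itself, the average is nondecreasing in \<open>\<bar>u\<bar>\<close>, so it can be compared through tails.
\<close>

definition sym_moment :: "real \<Rightarrow> real \<Rightarrow> real \<Rightarrow> real" where
  "sym_moment p a u = (\<bar>a + u\<bar> powr p + \<bar>a - u\<bar> powr p) / 2"

lemma sym_moment_abs: "sym_moment p \<bar>a\<bar> \<bar>u\<bar> = sym_moment p a u"
  unfolding sym_moment_def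
  by (cases "0 \<le> a"; cases "0 \<le> u") (simp_all add: abs_minus_commute add.commute)

lemma sym_moment_commute: "sym_moment p a u = sym_moment p u a"
  by (simp add: sym_moment_def abs_minus_commute add.commute)

lemma sym_moment_nonneg: "0 \<le> sym_moment p a u"
  by (simp add: sym_moment_def)

lemma sym_moment_le:
  assumes "0 \<le> a" "a \<le> 1" "0 \<le> u" "u \<le> 1" "1 \<le> p"
  shows "sym_moment p a u \<le> 2 powr p"
proof -
  have "\<bar>a + u\<bar> powr p \<le> 2 powr p" "\<bar>a - u\<bar> powr p \<le> 2 powr p"
    using assms by (auto intro!: powr_mono2)
  then show ?thesis by (simp add: sym_moment_def)
qed

lemma continuous_on_sym_moment:
  assumes "0 < p"
  shows "continuous_on UNIV (\<lambda>u. sym_moment p a u)"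
  unfolding sym_moment_def
  by (intro continuous_intros continuous_on_powr') (use assms in auto)

lemma borel_measurable_sym_moment [measurable]:
  assumes [measurable]: "f \<in> borel_measurable M" "g \<in> borel_measurable M"
  shows "(\<lambda>x. sym_moment p (f x) (g x)) \<in> borel_measurable M"
  unfolding sym_moment_def by measurable

text \<open>The points \<open>a + u\<close> and \<open>a - u\<close> are convex combinations of
  \<open>a + v\<close> and \<open>a - v\<close> with interchanged weights. Convexity bounds both
  powers, and in the sum the weights add up to 1.\<close>

lemma sym_moment_mono:
  assumes "0 \<le> a" "0 \<le> u" "u \<le> v" "1 \<le> p"
  shows "sym_moment p a u \<le> sym_moment p a v"
proof (cases "v = 0")
  case False
  then have v: "0 < v" using assms by simp
  \<comment> \<open>The solution of \<open>(1 - 2 * l) * v = u\<close>; the weight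
    \<open>1 - l\<close> gives \<open>- u\<close> instead.\<close>
  define l where "l = (v - u) / (2 * v)"
  have l: "0 \<le> l" "l \<le> 1" using assms v by (auto simp: l_def field_simps)
  have combo: "\<bar>a + (1 - 2 * t) * v\<bar> powr p \<le> (1 - t) * \<bar>a + v\<bar> powr p + t * \<bar>a - v\<bar> powr p"
    if "0 \<le> t" "t \<le> 1" for t
  proof -
    have "\<bar>a + (1 - 2 * t) * v\<bar> = \<bar>(1 - t) * (a + v) + t * (a - v)\<bar>"
      by (simp add: algebra_simps)
    also have "\<dots> \<le> (1 - t) * \<bar>a + v\<bar> + t * \<bar>a - v\<bar>"
      using abs_triangle_ineq[of "(1 - t) * (a + v)" "t * (a - v)"] that
      by (simp add: abs_mult)
    finally have "\<bar>a + (1 - 2 * t) * v\<bar> powr p \<le> ((1 - t) * \<bar>a + v\<bar> + t * \<bar>a - v\<bar>) powr p"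
      using assms by (intro powr_mono2) auto
    also have "\<dots> \<le> (1 - t) * \<bar>a + v\<bar> powr p + t * \<bar>a - v\<bar> powr p"
      using convex_onD[OF convex_on_powr_atLeast_0[OF assms(4)], of t "\<bar>a + v\<bar>" "\<bar>a - v\<bar>"] that
      by simp
    finally show ?thesis .
  qed
  have "(1 - 2 * l) * v = u" "(1 - 2 * (1 - l)) * v = - u"
    using v by (auto simp: l_def field_simps)
  with combo[of l] combo[of "1 - l"] l
  have "\<bar>a + u\<bar> powr p \<le> (1 - l) * \<bar>a + v\<bar> powr p + l * \<bar>a - v\<bar> powr p"
    "\<bar>a - u\<bar> powr p \<le> l * \<bar>a + v\<bar> powr p + (1 - l) * \<bar>a - v\<bar> powr p"
    by auto
  then show ?thesis
    by (simp add: sym_moment_def algebra_simps)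
qed (use assms in simp)

text \<open>Quantitative form with a gain independent of \<open>a\<close>. The gain comes from
  superadditivity in the term with \<open>a + t\<close>; the hypothesis \<open>a \<le> s\<close>
  keeps the other term from decreasing.\<close>

lemma sym_moment_strict_mono:
  assumes "0 \<le> a" "a \<le> s" "s \<le> t" "1 \<le> p"
  shows "(t - s) powr p / 2 \<le> sym_moment p a t - sym_moment p a s"
proof -
  have "(a + s) powr p + (t - s) powr p \<le> (a + t) powr p"
    using powr_superadditive[of "a + s" "t - s" p] assms by simp
  moreover have "(s - a) powr p \<le> (t - a) powr p"
    using assms by (intro powr_mono2) auto
  moreover have "\<bar>a - s\<bar> = s - a" "\<bar>a - t\<bar> = t - a" "\<bar>a + s\<bar> = a + s" "\<bar>a + t\<bar> = a + t"
    using assms by auto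
  ultimately show ?thesis unfolding sym_moment_def by (simp only:) (simp add: field_simps)
qed

text \<open>\<open>g x - c\<close> is the length of \<open>{c..<g x}\<close>; exchanging the two
  integrals leaves the measures of the superlevel sets.\<close>

lemma nn_integral_layer_cake:
  fixes g :: "real \<Rightarrow> real"
  assumes "sigma_finite_measure M" and [measurable_cong]: "sets M = sets borel"
    and g [measurable]: "g \<in> borel_measurable borel"
    and AE: "AE x in M. c \<le> g x \<and> g x \<le> C"
  shows "(\<integral>\<^sup>+x. ennreal (g x - c) \<partial>M)
    = (\<integral>\<^sup>+u. emeasure M {x. u < g x} * indicator {c..<C} u \<partial>lborel)"
proof -
  interpret sigma_finite_measure M by fact
  interpret pair_sigma_finite M lborel
    by (intro pair_sigma_finite.intro sigma_finite_lborel assms)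
  have sp: "space M = UNIV" using sets_eq_imp_space_eq[OF assms(2)] by simp
  let ?F = "\<lambda>x u. indicator {x. u < g x} x * indicator {c..<C} u :: ennreal"
  have "(\<integral>\<^sup>+x. ennreal (g x - c) \<partial>M) = (\<integral>\<^sup>+x. (\<integral>\<^sup>+u. ?F x u \<partial>lborel) \<partial>M)"
  proof (rule nn_integral_cong_AE, use AE in eventually_elim)
    case (elim x)
    have "(\<integral>\<^sup>+u. ?F x u \<partial>lborel) = (\<integral>\<^sup>+u. indicator {c..<g x} u \<partial>lborel)"
      using elim by (intro nn_integral_cong) (auto split: split_indicator)
    then show ?case using elim by simp
  qed
  also have "\<dots> = (\<integral>\<^sup>+u. (\<integral>\<^sup>+x. ?F x u \<partial>M) \<partial>lborel)"
    by (rule Fubini'[symmetric]) measurable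
  also have "\<dots> = (\<integral>\<^sup>+u. emeasure M {x. u < g x} * indicator {c..<C} u \<partial>lborel)"
  proof (rule nn_integral_cong)
    fix u
    have "(\<integral>\<^sup>+x. ?F x u \<partial>M) = (\<integral>\<^sup>+x. indicator {x. u < g x} x \<partial>M) * indicator {c..<C} u"
      by (intro nn_integral_multc) measurable
    also have "(\<integral>\<^sup>+x. indicator {x. u < g x} x \<partial>M) = emeasure M {x. u < g x}"
      by (intro nn_integral_indicator) measurable
    finally show "(\<integral>\<^sup>+x. ?F x u \<partial>M) = emeasure M {x. u < g x} * indicator {c..<C} u" .
  qed
  finally show ?thesis .
qed

text \<open>Superlevel sets of a monotone \<open>g\<close> are tails up to null sets, so the tail
  inequality can be integrated over the levels of \<open>g\<close>. The surplus
  \<open>\<kappa>\<close> is collected on the levels between \<open>g s1\<close> and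
  \<open>g s2\<close>, the error \<open>\<epsilon>\<close> on all levels between \<open>g 0\<close>
  and \<open>g 1\<close>.\<close>

lemma expectation_le_of_tails:
  fixes g :: "real \<Rightarrow> real"
  assumes \<nu>: "prob_space \<nu>" "sets \<nu> = sets borel" "AE x in \<nu>. 0 \<le> x \<and> x \<le> 1"
    and \<mu>: "prob_space \<mu>" "sets \<mu> = sets borel" "AE x in \<mu>. 0 \<le> x \<and> x \<le> 1"
    and tails: "\<And>s. 0 \<le> s \<Longrightarrow> s < 1 \<Longrightarrow>
      measure \<nu> {s<..} + (if s1 \<le> s \<and> s < s2 then \<kappa> else 0) \<le> measure \<mu> {s<..} + \<epsilon>"
    and s: "0 \<le> s1" "s1 \<le> s2" "s2 \<le> 1" and nonneg: "0 \<le> \<kappa>" "0 \<le> \<epsilon>"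
    and cont: "continuous_on UNIV g"
    and mono: "\<And>x y. 0 \<le> x \<Longrightarrow> x \<le> y \<Longrightarrow> y \<le> 1 \<Longrightarrow> g x \<le> g y"
  shows "(\<integral>x. g x \<partial>\<nu>) + \<kappa> * (g s2 - g s1) \<le> (\<integral>x. g x \<partial>\<mu>) + \<epsilon> * (g 1 - g 0)"
proof -
  interpret \<nu>: prob_space \<nu> by fact
  interpret \<mu>: prob_space \<mu> by fact
  have [measurable_cong]: "sets \<nu> = sets borel" "sets \<mu> = sets borel" by fact+
  have g [measurable]: "g \<in> borel_measurable borel"
    using cont by (rule borel_measurable_continuous_onI)
  have level: "emeasure \<nu> {x. u < g x} + ennreal \<kappa> * indicator {g s1..<g s2} u
      \<le> emeasure \<mu> {x. u < g x} + ennreal \<epsilon>" if u: "g 0 \<le> u" "u < g 1" for u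
  proof -
    \<comment> \<open>Continuity makes \<open>S\<close> compact, so it has a greatest element
      \<open>s\<close>, and on the unit interval \<open>u < g x\<close> becomes exactly
      \<open>s < x\<close>.\<close>
    define S where "S = {x \<in> {0..1}. g x \<le> u}"
    have "compact S"
    proof -
      have "closed (g -` {..u})" by (intro closed_vimage closed_atMost cont)
      then have "compact ({0..1} \<inter> g -` {..u})" by (intro compact_Int_closed compact_Icc)
      moreover have "S = {0..1} \<inter> g -` {..u}" by (auto simp: S_def)
      ultimately show ?thesis by simp
    qed
    moreover have "S \<noteq> {}" using u by (auto simp: S_def intro!: exI[of _ 0])
    ultimately obtain s where sS: "s \<in> S" and smax: "\<And>x. x \<in> S \<Longrightarrow> x \<le> s"
      using compact_attains_sup[of S] by auto
    have s01: "0 \<le> s" "s < 1" using sS u by (auto simp: S_def less_le)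
    have eq: "u < g x \<longleftrightarrow> s < x" if "0 \<le> x" "x \<le> 1" for x
      using smax[of x] mono[of x s] sS that by (force simp: S_def)
    have *: "emeasure M {x. u < g x} = ennreal (measure M {s<..})"
      if "prob_space M" "sets M = sets borel" "AE x in M. 0 \<le> x \<and> x \<le> 1" for M :: "real measure"
    proof -
      interpret M: prob_space M by fact
      have [measurable_cong]: "sets M = sets borel" by fact
      have "emeasure M {x. u < g x} = emeasure M {s<..}"
      proof (rule emeasure_eq_AE)
        show "AE x in M. (x \<in> {x. u < g x}) = (x \<in> {s<..})"
          using that(3) by eventually_elim (simp add: eq)
      qed measurable
      then show ?thesis by (simp add: M.emeasure_eq_measure)
    qed
    \<comment> \<open>By this equivalence at \<open>s1\<close> and \<open>s2\<close>, the level
      \<open>u\<close> lies in \<open>{g s1..<g s2}\<close> exactly when \<open>s1 \<le> s\<close>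
      and \<open>s < s2\<close>.\<close>
    have "indicator {g s1..<g s2} u = (if s1 \<le> s \<and> s < s2 then 1 else 0 :: ennreal)"
      using eq[of s1] eq[of s2] s by (cases "u < g s1"; cases "u < g s2") auto
    then have "emeasure \<nu> {x. u < g x} + ennreal \<kappa> * indicator {g s1..<g s2} u
      = ennreal (measure \<nu> {s<..} + (if s1 \<le> s \<and> s < s2 then \<kappa> else 0))"
      using *[OF \<nu>] nonneg by simp
    also have "\<dots> \<le> ennreal (measure \<mu> {s<..} + \<epsilon>)"
      using tails[OF s01] by (rule ennreal_leI)
    also have "\<dots> = emeasure \<mu> {x. u < g x} + ennreal \<epsilon>"
      using *[OF \<mu>] nonneg by simp
    finally show ?thesis .
  qed
  have ineqs: "g 0 \<le> g s1" "g s1 \<le> g s2" "g s2 \<le> g 1" "g 0 \<le> g 1"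
    using s by (auto intro!: mono)
  have bound: "AE x in M. g 0 \<le> g x \<and> g x \<le> g 1" if "AE x in M. 0 \<le> x \<and> x \<le> 1" for M
    using that by eventually_elim (auto intro!: mono)
  have cake: "(\<integral>\<^sup>+u. emeasure M {x. u < g x} * indicator {g 0..<g 1} u \<partial>lborel)
      = ennreal ((\<integral>x. g x \<partial>M) - g 0)" "g 0 \<le> (\<integral>x. g x \<partial>M)"
    if "prob_space M" "sets M = sets borel" "AE x in M. 0 \<le> x \<and> x \<le> 1" for M :: "real measure"
  proof -
    interpret M: prob_space M by fact
    have [measurable_cong]: "sets M = sets borel" by fact
    have b: "AE x in M. g 0 \<le> g x \<and> g x \<le> g 1" using that by (intro bound)
    have int: "integrable M g"
    proof (rule M.integrable_const_bound)
      show "AE x in M. norm (g x) \<le> \<bar>g 0\<bar> + \<bar>g 1\<bar>" using b by eventually_elim auto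
    qed measurable
    show "g 0 \<le> (\<integral>x. g x \<partial>M)"
      by (rule M.integral_ge_const[OF int]) (use b in \<open>eventually_elim, simp\<close>)
    have "(\<integral>\<^sup>+x. ennreal (g x - g 0) \<partial>M) = ennreal (\<integral>x. g x - g 0 \<partial>M)"
      by (rule nn_integral_eq_integral) (use int in simp, use b in \<open>eventually_elim, simp\<close>)
    also have "(\<integral>x. g x - g 0 \<partial>M) = (\<integral>x. g x \<partial>M) - g 0"
      using int by (simp add: M.prob_space)
    finally show "(\<integral>\<^sup>+u. emeasure M {x. u < g x} * indicator {g 0..<g 1} u \<partial>lborel)
      = ennreal ((\<integral>x. g x \<partial>M) - g 0)"
      using nn_integral_layer_cake[of M g "g 0" "g 1"] b that M.sigma_finite_measure_axioms by simp
  qed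
  have [measurable]: "(\<lambda>u. emeasure M {x. u < g x}) \<in> borel_measurable lborel"
    if "prob_space M" "sets M = sets borel" for M :: "real measure"
  proof -
    interpret M: prob_space M by fact
    have [measurable_cong]: "sets M = sets borel" by fact
    have sp: "space M = UNIV" using sets_eq_imp_space_eq[OF that(2)] by simp
    have "(\<lambda>u. emeasure M {x \<in> space M. u < g x}) \<in> borel_measurable lborel"
      by measurable
    then show ?thesis by (simp add: sp)
  qed
  note m\<nu> = this[OF \<nu>(1,2)] and m\<mu> = this[OF \<mu>(1,2)]
  have "ennreal ((\<integral>x. g x \<partial>\<nu>) - g 0) + ennreal \<kappa> * ennreal (g s2 - g s1)
      = (\<integral>\<^sup>+u. emeasure \<nu> {x. u < g x} * indicator {g 0..<g 1} u
          + ennreal \<kappa> * indicator {g s1..<g s2} u \<partial>lborel)"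
    using m\<nu> ineqs cake[OF \<nu>] by (simp add: nn_integral_add nn_integral_cmult)
  also have "\<dots> \<le> (\<integral>\<^sup>+u. emeasure \<mu> {x. u < g x} * indicator {g 0..<g 1} u
          + ennreal \<epsilon> * indicator {g 0..<g 1} u \<partial>lborel)"
    using level ineqs by (intro nn_integral_mono) (auto simp: indicator_def)
  also have "\<dots> = ennreal ((\<integral>x. g x \<partial>\<mu>) - g 0) + ennreal \<epsilon> * ennreal (g 1 - g 0)"
    using m\<mu> ineqs cake[OF \<mu>] by (simp add: nn_integral_add nn_integral_cmult)
  finally have "ennreal ((\<integral>x. g x \<partial>\<nu>) - g 0 + \<kappa> * (g s2 - g s1))
      \<le> ennreal ((\<integral>x. g x \<partial>\<mu>) - g 0 + \<epsilon> * (g 1 - g 0))"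
    using ineqs nonneg cake(2)[OF \<nu>] cake(2)[OF \<mu>]
    by (simp add: ennreal_mult')
  then show ?thesis
    using ineqs nonneg cake(2)[OF \<mu>] by (subst (asm) ennreal_le_iff) auto
qed

section \<open>Pairs of independent variables and their energy\<close>

lemma AE_pair_measure_conj:
  assumes "prob_space M" "prob_space N" "AE x in M. P x" "AE y in N. Q y"
  shows "AE z in M \<Otimes>\<^sub>M N. P (fst z) \<and> Q (snd z)"
proof -
  interpret M: prob_space M by fact
  interpret N: prob_space N by fact
  interpret pair_prob_space M N ..
  have "AE z in M \<Otimes>\<^sub>M N. P (fst z)"
    using assms(3) by (intro AE_distrD[OF measurable_fst]) (simp only: N.distr_pair_fst)
  moreover have "AE z in M \<Otimes>\<^sub>M N. Q (snd z)"
  proof -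
    obtain A where A: "A \<in> null_sets N" "{y \<in> space N. \<not> Q y} \<subseteq> A"
      using assms(4) by (auto simp: eventually_ae_filter)
    have "emeasure (M \<Otimes>\<^sub>M N) (space M \<times> A) = 0"
      using A by (subst N.emeasure_pair_measure_Times) auto
    then have "space M \<times> A \<in> null_sets (M \<Otimes>\<^sub>M N)"
      using A by auto
    then show ?thesis
      by (rule AE_I') (use A in \<open>auto simp: space_pair_measure\<close>)
  qed
  ultimately show ?thesis by eventually_elim simp
qed

text \<open>If \<open>T\<close> and \<open>T'\<close> are independent with the same symmetric law
  and \<open>\<mu>\<close> is the law of \<open>\<bar>T\<bar>\<close>, this is the expectation of
  \<open>\<bar>T - T'\<bar> powr p\<close>.\<close>

definition sym_energy :: "real \<Rightarrow> real measure \<Rightarrow> real" where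
  "sym_energy p \<mu> = (\<integral>a. \<integral>u. sym_moment p a u \<partial>\<mu> \<partial>\<mu>)"

text \<open>\<open>\<nu>\<close> is replaced by \<open>\<mu>\<close> in one variable at a time, at
  cost \<open>\<epsilon> * 2 powr p\<close> each. The surplus \<open>\<kappa>\<close> is dropped in
  the first replacement and kept in the second, where \<open>sym_moment_strict_mono\<close> gives a
  gain whenever the outer variable is at most \<open>s1\<close>.\<close>

lemma sym_energy_gap:
  assumes \<nu>: "prob_space \<nu>" "sets \<nu> = sets borel" "AE x in \<nu>. 0 \<le> x \<and> x \<le> 1"
    and \<mu>: "prob_space \<mu>" "sets \<mu> = sets borel" "AE x in \<mu>. 0 \<le> x \<and> x \<le> 1"
    and tails: "\<And>s. 0 \<le> s \<Longrightarrow> s < 1 \<Longrightarrow>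
      measure \<nu> {s<..} + (if s1 \<le> s \<and> s < s2 then \<kappa> else 0) \<le> measure \<mu> {s<..} + \<epsilon>"
    and s: "0 \<le> s1" "s1 \<le> s2" "s2 \<le> 1" and nonneg: "0 \<le> \<kappa>" "0 \<le> \<epsilon>"
    and p: "1 \<le> p"
  shows "sym_energy p \<nu> + \<kappa> * ((s2 - s1) powr p / 2) * measure \<mu> {..s1}
    \<le> sym_energy p \<mu> + 2 * \<epsilon> * 2 powr p"
proof -
  interpret \<nu>: prob_space \<nu> by fact
  interpret \<mu>: prob_space \<mu> by fact
  interpret pair_prob_space \<nu> \<mu> ..
  have [measurable_cong]: "sets \<nu> = sets borel" "sets \<mu> = sets borel" by fact+
  let ?h = "sym_moment p"
  have h01: "AE u in M. 0 \<le> ?h a u \<and> ?h a u \<le> 2 powr p"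
    if "AE x in M. 0 \<le> x \<and> x \<le> 1" "0 \<le> a" "a \<le> 1" for a and M :: "real measure"
    using that(1) by eventually_elim (use that p in \<open>auto intro!: sym_moment_le sym_moment_nonneg\<close>)
  have int1: "integrable M (?h a)" and le1: "(\<integral>u. ?h a u \<partial>M) \<le> 2 powr p"
    and ge1: "0 \<le> (\<integral>u. ?h a u \<partial>M)"
    if "prob_space M" "sets M = sets borel" "AE x in M. 0 \<le> x \<and> x \<le> 1" "0 \<le> a" "a \<le> 1"
    for a and M :: "real measure"
  proof -
    interpret M: prob_space M by fact
    have [measurable_cong]: "sets M = sets borel" by fact
    show int: "integrable M (?h a)"
      by (rule M.integrable_const_bound[of _ "2 powr p"])
        (use h01[OF that(3-5)] in \<open>eventually_elim, auto\<close>, measurable)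
    show "(\<integral>u. ?h a u \<partial>M) \<le> 2 powr p"
      by (rule M.integral_le_const[OF int]) (use h01[OF that(3-5)] in \<open>eventually_elim, auto\<close>)
    show "0 \<le> (\<integral>u. ?h a u \<partial>M)"
      by (rule M.integral_ge_const[OF int]) (use h01[OF that(3-5)] in \<open>eventually_elim, auto\<close>)
  qed
  have int2: "integrable M (\<lambda>a. \<integral>u. ?h a u \<partial>N)"
    if "prob_space M" "sets M = sets borel" "AE x in M. 0 \<le> x \<and> x \<le> 1"
      "prob_space N" "sets N = sets borel" "AE x in N. 0 \<le> x \<and> x \<le> 1"
    for M N :: "real measure"
  proof -
    interpret M: prob_space M by fact
    interpret N: prob_space N by fact
    have [measurable_cong]: "sets M = sets borel" "sets N = sets borel" by fact+
    have "AE a in M. norm (\<integral>u. ?h a u \<partial>N) \<le> 2 powr p"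
      using that(3) by eventually_elim (use le1[OF that(4-6)] ge1[OF that(4-6)] in auto)
    then show ?thesis by (intro M.integrable_const_bound[of _ "2 powr p"]) auto
  qed
  have inth: "integrable (\<nu> \<Otimes>\<^sub>M \<mu>) (\<lambda>(a, u). ?h a u)"
  proof (rule integrable_const_bound[of _ "2 powr p"])
    have "AE z in \<nu> \<Otimes>\<^sub>M \<mu>. (0 \<le> fst z \<and> fst z \<le> 1) \<and> (0 \<le> snd z \<and> snd z \<le> 1)"
      by (rule AE_pair_measure_conj[OF \<nu>(1) \<mu>(1) \<nu>(3) \<mu>(3)])
    then show "AE z in \<nu> \<Otimes>\<^sub>M \<mu>. norm (case z of (a, u) \<Rightarrow> ?h a u) \<le> 2 powr p"
      by eventually_elim (use p in \<open>auto simp: sym_moment_nonneg intro!: sym_moment_le\<close>)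
  qed measurable
  let ?\<eta> = "(s2 - s1) powr p / 2"
  have step: "(\<integral>u. ?h a u \<partial>\<nu>) + \<kappa> * (?h a s2 - ?h a s1) \<le> (\<integral>u. ?h a u \<partial>\<mu>) + \<epsilon> * 2 powr p"
    if "0 \<le> a" "a \<le> 1" for a
  proof -
    have "?h a 1 - ?h a 0 \<le> 2 powr p"
      using sym_moment_le[of a 1 p] sym_moment_nonneg[of p a 0] that p by simp
    then have "\<epsilon> * (?h a 1 - ?h a 0) \<le> \<epsilon> * 2 powr p" using nonneg by (intro mult_left_mono) auto
    moreover have "(\<integral>u. ?h a u \<partial>\<nu>) + \<kappa> * (?h a s2 - ?h a s1)
        \<le> (\<integral>u. ?h a u \<partial>\<mu>) + \<epsilon> * (?h a 1 - ?h a 0)"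
      by (rule expectation_le_of_tails[OF \<nu> \<mu> tails s nonneg continuous_on_sym_moment])
        (use that p in \<open>auto intro!: sym_moment_mono\<close>)
    ultimately show ?thesis by linarith
  qed
  have ind: "integrable \<mu> (indicator {..s1} :: real \<Rightarrow> real)"
    by (rule \<mu>.integrable_const_bound[of _ 1]) (auto simp: indicator_def)
  have "sym_energy p \<nu> \<le> (\<integral>a. (\<integral>u. ?h a u \<partial>\<mu>) + \<epsilon> * 2 powr p \<partial>\<nu>)"
    unfolding sym_energy_def
  proof (rule integral_mono_AE)
    show "AE a in \<nu>. (\<integral>u. ?h a u \<partial>\<nu>) \<le> (\<integral>u. ?h a u \<partial>\<mu>) + \<epsilon> * 2 powr p"
      using \<nu>(3)
    proof eventually_elim
      case (elim a)
      have "0 \<le> \<kappa> * (?h a s2 - ?h a s1)"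
        using elim nonneg s p by (intro mult_nonneg_nonneg) (auto intro!: sym_moment_mono)
      then show ?case using step[of a] elim by linarith
    qed
  qed (use int2[OF \<nu> \<nu>] int2[OF \<nu> \<mu>] in auto)
  also have "\<dots> = (\<integral>a. \<integral>u. ?h a u \<partial>\<mu> \<partial>\<nu>) + \<epsilon> * 2 powr p"
    using int2[OF \<nu> \<mu>] by (simp add: \<nu>.prob_space)
  \<comment> \<open>The kernel is symmetric, so after Fubini the remaining copy of
    \<open>\<nu>\<close> is again in the inner integral.\<close>
  also have "(\<integral>a. \<integral>u. ?h a u \<partial>\<mu> \<partial>\<nu>) = (\<integral>u. \<integral>a. ?h u a \<partial>\<nu> \<partial>\<mu>)"
    using Fubini_integral[OF inth] by (simp add: sym_moment_commute[of p])
  also have "\<dots> \<le> (\<integral>u. (\<integral>a. ?h u a \<partial>\<mu>) + \<epsilon> * 2 powr p - \<kappa> * ?\<eta> * indicator {..s1} u \<partial>\<mu>)"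
  proof (rule integral_mono_AE)
    show "AE u in \<mu>. (\<integral>a. ?h u a \<partial>\<nu>) \<le> (\<integral>a. ?h u a \<partial>\<mu>) + \<epsilon> * 2 powr p - \<kappa> * ?\<eta> * indicator {..s1} u"
      using \<mu>(3)
    proof eventually_elim
      case (elim u)
      have "\<kappa> * ?\<eta> * indicator {..s1} u \<le> \<kappa> * (?h u s2 - ?h u s1)"
      proof (cases "u \<le> s1")
        case True
        then show ?thesis
          using elim nonneg s p by (simp del: times_divide_eq_right, intro mult_left_mono sym_moment_strict_mono) auto
      next
        case False
        have "0 \<le> \<kappa> * (?h u s2 - ?h u s1)"
          using elim nonneg s p by (intro mult_nonneg_nonneg) (auto intro!: sym_moment_mono)
        with False show ?thesis by simp
      qed
      then show ?case using step[of u] elim by linarith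
    qed
    show "integrable \<mu> (\<lambda>u. (\<integral>a. ?h u a \<partial>\<mu>) + \<epsilon> * 2 powr p - \<kappa> * ?\<eta> * indicator {..s1} u)"
      using int2[OF \<mu> \<mu>] ind by auto
  qed (use int2[OF \<mu> \<nu>] in auto)
  also have "\<dots> = sym_energy p \<mu> + \<epsilon> * 2 powr p - \<kappa> * ?\<eta> * measure \<mu> {..s1}"
    unfolding sym_energy_def using int2[OF \<mu> \<mu>] ind
    by (subst Bochner_Integration.integral_diff) (auto simp: \<mu>.prob_space)
  finally show ?thesis by simp
qed

text \<open>Invariance of \<open>U\<close> under \<open>uminus\<close> allows the inner integrand to
  be averaged over \<open>y\<close> and \<open>- y\<close>; the average depends only on the absolute
  values of the two coordinates.\<close>

lemma linear_moment_eq_sym_energy: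
  fixes e :: "'a::euclidean_space"
  assumes U: "prob_space U" "sets U = sets borel" "AE v in U. \<bar>v \<bullet> e\<bar> \<le> 1"
    and sym: "distr U borel uminus = U" and p: "1 \<le> p"
  shows "integrable (U \<Otimes>\<^sub>M U) (\<lambda>(x, y). \<bar>x \<bullet> e - y \<bullet> e\<bar> powr p)"
    and "(\<integral>(x, y). \<bar>x \<bullet> e - y \<bullet> e\<bar> powr p \<partial>(U \<Otimes>\<^sub>M U)) = sym_energy p (distr U borel (\<lambda>v. \<bar>v \<bullet> e\<bar>))"
proof -
  interpret U: prob_space U by fact
  interpret pair_prob_space U U ..
  have [measurable_cong]: "sets U = sets borel" by fact
  let ?f = "\<lambda>x y. \<bar>x \<bullet> e - y \<bullet> e\<bar> powr p"
  have bd: "AE z in U \<Otimes>\<^sub>M U. \<bar>fst z \<bullet> e\<bar> \<le> 1 \<and> \<bar>snd z \<bullet> e\<bar> \<le> 1"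
    by (rule AE_pair_measure_conj[OF U(1,1,3,3)])
  show int: "integrable (U \<Otimes>\<^sub>M U) (\<lambda>(x, y). ?f x y)"
  proof (rule integrable_const_bound[of _ "2 powr p"])
    show "AE z in U \<Otimes>\<^sub>M U. norm (case z of (x, y) \<Rightarrow> ?f x y) \<le> 2 powr p"
      using bd by eventually_elim (use p in \<open>auto intro!: powr_mono2\<close>)
  qed measurable
  have int1: "integrable U (\<lambda>y. \<bar>c + y \<bullet> e\<bar> powr p)" "integrable U (\<lambda>y. \<bar>c - y \<bullet> e\<bar> powr p)" for c
  proof -
    have "AE y in U. norm (\<bar>c + y \<bullet> e\<bar> powr p) \<le> (\<bar>c\<bar> + 1) powr p"
      "AE y in U. norm (\<bar>c - y \<bullet> e\<bar> powr p) \<le> (\<bar>c\<bar> + 1) powr p"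
      using U(3) by (eventually_elim, use p in \<open>force intro!: powr_mono2\<close>)+
    note * = this[THEN U.integrable_const_bound]
    show "integrable U (\<lambda>y. \<bar>c + y \<bullet> e\<bar> powr p)" by (rule *(1)) measurable
    show "integrable U (\<lambda>y. \<bar>c - y \<bullet> e\<bar> powr p)" by (rule *(2)) measurable
  qed
  have inner: "(\<integral>y. ?f x y \<partial>U) = (\<integral>u. sym_moment p \<bar>x \<bullet> e\<bar> u \<partial>distr U borel (\<lambda>v. \<bar>v \<bullet> e\<bar>))" for x
  proof -
    have "(\<integral>y. ?f x y \<partial>U) = (\<integral>y. ?f x y \<partial>distr U borel uminus)" by (simp only: sym)
    also have "\<dots> = (\<integral>y. \<bar>x \<bullet> e + y \<bullet> e\<bar> powr p \<partial>U)"
      by (subst integral_distr) auto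
    finally have "(\<integral>y. ?f x y \<partial>U) = (\<integral>y. sym_moment p (x \<bullet> e) (y \<bullet> e) \<partial>U)"
      unfolding sym_moment_def using int1[of "x \<bullet> e"] by simp
    then show ?thesis
      by (subst integral_distr) (auto simp: sym_moment_abs)
  qed
  have "(\<integral>(x, y). ?f x y \<partial>(U \<Otimes>\<^sub>M U)) = (\<integral>x. \<integral>y. ?f x y \<partial>U \<partial>U)"
    using integral_fst[OF int] by simp
  also have "\<dots> = sym_energy p (distr U borel (\<lambda>v. \<bar>v \<bullet> e\<bar>))"
  proof -
    interpret D: prob_space "distr U borel (\<lambda>v. \<bar>v \<bullet> e\<bar>)" by (intro U.prob_space_distr) auto
    show ?thesis
      unfolding sym_energy_def inner by (subst (2) integral_distr) auto
  qed
  finally show "(\<integral>(x, y). ?f x y \<partial>(U \<Otimes>\<^sub>M U)) = sym_energy p (distr U borel (\<lambda>v. \<bar>v \<bullet> e\<bar>))" .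
qed

section \<open>Hausdorff measure and uniform measures\<close>

lemma diameter_leI:
  fixes S :: "'a::metric_space set"
  assumes "0 \<le> d" "\<And>x y. x \<in> S \<Longrightarrow> y \<in> S \<Longrightarrow> dist x y \<le> d"
  shows "diameter S \<le> d"
  unfolding diameter_def using assms by (auto intro!: cSUP_least)

text \<open>A cover of \<open>A\<close> is pushed forward by \<open>f\<close>: diameters grow at
  most by the factor \<open>L\<close>, hence weights by \<open>L ^ k\<close>. Dividing by this
  factor first lets the bound pass to the infimum over covers.\<close>

lemma hausdorff_content_lipschitz_le:
  fixes f :: "'a::metric_space \<Rightarrow> 'b::metric_space"
  assumes L: "0 < L" and lip: "\<And>x y. x \<in> A \<Longrightarrow> y \<in> A \<Longrightarrow> dist (f x) (f y) \<le> L * dist x y"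
    and B: "B \<subseteq> f ` A"
  shows "hausdorff_content k (L * \<delta>) B \<le> ennreal (L ^ k) * hausdorff_content k \<delta> A"
proof -
  let ?c = "ennreal (L ^ k)"
  have c: "0 < ?c" "?c \<noteq> 0" "?c \<noteq> top" using L by auto
  have "hausdorff_content k (L * \<delta>) B / ?c \<le> hausdorff_content k \<delta> A"
    unfolding hausdorff_content_def[of k \<delta> A]
  proof (rule INF_greatest)
    fix U :: "nat \<Rightarrow> 'a set"
    assume "U \<in> {U. A \<subseteq> (\<Union>i. U i) \<and> (\<forall>i. bounded (U i) \<and> diameter (U i) \<le> \<delta>)}"
    then have U: "A \<subseteq> (\<Union>i. U i)" "\<And>i. bounded (U i)" "\<And>i. diameter (U i) \<le> \<delta>" by auto
    \<comment> \<open>Intersecting with \<open>A\<close> confines \<open>f\<close> to the set on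
      which its Lipschitz bound holds.\<close>
    define V where "V i = f ` (A \<inter> U i)" for i
    have Vdist: "dist x y \<le> L * diameter (U i)" if Vi: "x \<in> V i" "y \<in> V i" for x y i
    proof -
      obtain x' y' where xy: "x' \<in> A \<inter> U i" "y' \<in> A \<inter> U i" "x = f x'" "y = f y'"
        using Vi unfolding V_def by blast
      have "dist x y \<le> L * dist x' y'" using xy lip by auto
      also have "\<dots> \<le> L * diameter (U i)"
        using xy U L by (intro mult_left_mono diameter_bounded_bound) auto
      finally show ?thesis .
    qed
    have Vb: "bounded (V i)" for i
      unfolding bounded_two_points using Vdist by blast
    have Vd: "diameter (V i) \<le> L * diameter (U i)" for i
      using Vdist L U by (intro diameter_leI) (auto simp: diameter_ge_0)
    have "hausdorff_content k (L * \<delta>) B \<le> (\<Sum>i. hausdorff_weight k (V i))"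
      unfolding hausdorff_content_def
    proof (rule INF_lower, intro CollectI conjI allI)
      show "B \<subseteq> (\<Union>i. V i)" using U(1) B by (force simp: V_def)
      show "diameter (V i) \<le> L * \<delta>" for i
        using Vd[of i] U(3)[of i] L by (meson mult_le_cancel_left_pos order_trans)
    qed (rule Vb)
    also have "\<dots> \<le> (\<Sum>i. ?c * hausdorff_weight k (U i))"
    proof (intro suminf_le summableI)
      fix i
      show "hausdorff_weight k (V i) \<le> ?c * hausdorff_weight k (U i)"
      \<comment> \<open>An empty \<open>V i\<close> weighs 0 by definition; otherwise
        \<open>U i\<close> is nonempty too, and both weights are given by the formula, also for
        \<open>k = 0\<close>.\<close>
      proof (cases "V i = {}")
        case False
        then have "U i \<noteq> {}" by (auto simp: V_def)
        have "unit_ball_vol (real k) * (diameter (V i) / 2) ^ k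
            \<le> unit_ball_vol (real k) * (L * diameter (U i) / 2) ^ k"
          using Vd[of i] Vb[of i]
          by (intro mult_left_mono power_mono divide_right_mono) (auto simp: diameter_ge_0)
        also have "\<dots> = L ^ k * (unit_ball_vol (real k) * (diameter (U i) / 2) ^ k)"
          by (simp add: power_divide power_mult_distrib)
        finally show ?thesis
          using False \<open>U i \<noteq> {}\<close> L U(2)[of i]
          by (simp add: hausdorff_weight_def diameter_ge_0 ennreal_leI flip: ennreal_mult)
      qed (simp add: hausdorff_weight_def)
    qed
    also have "\<dots> = ?c * (\<Sum>i. hausdorff_weight k (U i))" by simp
    finally show "hausdorff_content k (L * \<delta>) B / ?c \<le> (\<Sum>i. hausdorff_weight k (U i))"
      by (rule divide_le_posI_ennreal[OF c(1)])
  qed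
  then have "hausdorff_content k (L * \<delta>) B / ?c * ?c \<le> hausdorff_content k \<delta> A * ?c"
    by (rule mult_right_mono) simp
  moreover have "hausdorff_content k (L * \<delta>) B / ?c * ?c = hausdorff_content k (L * \<delta>) B"
    using c by (simp add: ennreal_divide_times)
  ultimately show ?thesis by (simp add: mult.commute)
qed

text \<open>Mesh \<open>\<delta>\<close> for \<open>B\<close> corresponds to mesh
  \<open>\<delta> / L\<close> for \<open>A\<close>, and both run through all positive reals.\<close>

lemma hausdorff_outer_lipschitz_le:
  fixes f :: "'a::metric_space \<Rightarrow> 'b::metric_space"
  assumes L: "0 < L" and lip: "\<And>x y. x \<in> A \<Longrightarrow> y \<in> A \<Longrightarrow> dist (f x) (f y) \<le> L * dist x y"
    and B: "B \<subseteq> f ` A"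
  shows "hausdorff_outer k B \<le> ennreal (L ^ k) * hausdorff_outer k A"
  unfolding hausdorff_outer_def[of k B]
proof (rule SUP_least)
  fix \<delta> :: real assume "\<delta> \<in> {0<..}"
  then have "hausdorff_content k (L * (\<delta> / L)) B \<le> ennreal (L ^ k) * hausdorff_content k (\<delta> / L) A"
    using hausdorff_content_lipschitz_le[OF L lip B] by blast
  also have "\<dots> \<le> ennreal (L ^ k) * hausdorff_outer k A"
    unfolding hausdorff_outer_def using \<open>\<delta> \<in> {0<..}\<close> L by (intro mult_left_mono SUP_upper) auto
  finally show "hausdorff_content k \<delta> B \<le> ennreal (L ^ k) * hausdorff_outer k A"
    using L by simp
qed

lemma sets_hausdorff_measure [measurable_cong, simp]: "sets (hausdorff_measure k) = sets borel"
  unfolding hausdorff_measure_def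
  by (metis sets.sets_measure_of_eq space_borel)

lemma space_hausdorff_measure [simp]: "space (hausdorff_measure k) = UNIV"
  unfolding hausdorff_measure_def by (simp add: space_measure_of_conv)

text \<open>The value 0 is the default of \<open>measure_of\<close> for functions that are not
  measures and of \<open>emeasure\<close> off the Borel sets. Comparisons of outer measures carry
  over in either case.\<close>

lemma emeasure_hausdorff_measure:
  fixes A :: "'a::metric_space set"
  shows
  "emeasure (hausdorff_measure k) A =
    (if A \<in> sets borel \<and> measure_space UNIV (sets borel) (hausdorff_outer k :: 'a set \<Rightarrow> ennreal)
     then hausdorff_outer k A else 0)"
proof -
  have "sigma_sets UNIV (sets borel) = (sets borel :: 'a set set)"
    using sets.sigma_sets_eq[of borel] by simp
  then show ?thesis
    unfolding hausdorff_measure_def emeasure_measure_of_conv by simp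
qed

text \<open>A set \<open>B\<close> that is not Borel has measure 0 here, so Borel measurability is
  asked of \<open>A\<close> alone.\<close>

lemma emeasure_hausdorff_measure_lipschitz_le:
  fixes f :: "'a::metric_space \<Rightarrow> 'a"
  assumes "0 < L" "\<And>x y. x \<in> A \<Longrightarrow> y \<in> A \<Longrightarrow> dist (f x) (f y) \<le> L * dist x y"
    and "B \<subseteq> f ` A" and A: "A \<in> sets borel"
  shows "emeasure (hausdorff_measure k) B \<le> ennreal (L ^ k) * emeasure (hausdorff_measure k) A"
  using hausdorff_outer_lipschitz_le[OF assms(1-3), of k] A
  by (simp add: emeasure_hausdorff_measure)

section \<open>Reflection symmetry of uniform measures\<close>

lemma distr_uminus_uniform_measure:
  fixes M :: "'a::euclidean_space measure"
  assumes [measurable_cong]: "sets M = sets borel"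
    and sym: "\<And>A. A \<in> sets borel \<Longrightarrow> emeasure M (uminus -` A) = emeasure M A"
    and F [measurable]: "F \<in> sets borel" and F_sym: "uminus -` F = F"
  shows "distr (uniform_measure M F) borel uminus = uniform_measure M F"
proof (rule measure_eqI)
  fix A :: "'a set" assume "A \<in> sets (distr (uniform_measure M F) borel uminus)"
  then have [measurable]: "A \<in> sets borel" by simp
  have sp: "space M = UNIV" using sets_eq_imp_space_eq[OF assms(1)] by simp
  have [measurable]: "uminus -` A \<in> sets borel"
    using measurable_sets[of uminus "borel :: 'a measure" borel A] by simp
  have "emeasure (distr (uniform_measure M F) borel uminus) A = emeasure M (F \<inter> uminus -` A) / emeasure M F"
    by (subst emeasure_distr) (simp_all add: sp)
  also have "F \<inter> uminus -` A = uminus -` (F \<inter> A)" using F_sym by blast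
  also have "emeasure M (uminus -` (F \<inter> A)) = emeasure M (F \<inter> A)" by (rule sym) measurable
  finally show "emeasure (distr (uniform_measure M F) borel uminus) A = emeasure (uniform_measure M F) A"
    by simp
qed (simp add: assms(1))

lemma emeasure_lborel_uminus:
  assumes [measurable]: "A \<in> sets borel"
  shows "emeasure lborel (uminus -` A) = emeasure lborel (A :: 'a::euclidean_space set)"
proof -
  have "emeasure lborel A
      = emeasure (density (distr lborel borel (\<lambda>x::'a. 0 + (-1) *\<^sub>R x)) (\<lambda>_. ennreal (\<bar>-1\<bar> ^ DIM('a)))) A"
    by (rule arg_cong[OF lborel_affine, where f = "\<lambda>M. emeasure M A"]) simp
  also have "\<dots> = emeasure (distr lborel borel uminus) A" by (simp add: density_1)
  also have "\<dots> = emeasure lborel (uminus -` A)" by (subst emeasure_distr) auto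
  finally show ?thesis by simp
qed

text \<open>Reflection is an isometry and its own inverse, so the Lipschitz bound with
  \<open>L = 1\<close> applies in both directions.\<close>

lemma emeasure_hausdorff_measure_uminus:
  assumes [measurable]: "A \<in> sets borel"
  shows "emeasure (hausdorff_measure k) (uminus -` A) = emeasure (hausdorff_measure k) (A :: 'a::euclidean_space set)"
proof (rule antisym)
  have [measurable]: "uminus -` A \<in> sets borel"
    using measurable_sets[of uminus "borel :: 'a measure" borel A] by simp
  have d: "dist (- x) (- y) \<le> 1 * dist x y" for x y :: 'a
    by (simp add: dist_minus)
  have "uminus -` A \<subseteq> uminus ` A" "A \<subseteq> uminus ` (uminus -` A)"
    by (force simp: image_iff)+
  note this[THEN emeasure_hausdorff_measure_lipschitz_le[OF zero_less_one d], of k]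
  then show "emeasure (hausdorff_measure k) (uminus -` A) \<le> emeasure (hausdorff_measure k) A"
    "emeasure (hausdorff_measure k) A \<le> emeasure (hausdorff_measure k) (uminus -` A)"
    by simp_all
qed

text \<open>In \<open>ennreal\<close> both \<open>0 / 0\<close> and
  \<open>\<infinity> / \<infinity>\<close> are 0, so the uniform measure has total mass 0.\<close>

lemma distance_moment_uniform_degenerate:
  fixes M :: "'a::euclidean_space measure"
  assumes sets: "sets M = sets borel" and F: "F \<in> sets borel"
    and deg: "emeasure M F = 0 \<or> emeasure M F = \<infinity>"
  shows "distance_moment p (uniform_measure M F) = 0"
proof -
  let ?U = "uniform_measure M F"
  have zero: "emeasure ?U (space ?U) = 0"
  proof -
    have "space M \<in> sets M" by simp
    then have "emeasure ?U (space ?U) = emeasure M (F \<inter> space M) / emeasure M F"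
      using F sets by simp
    also have "F \<inter> space M = F" using sets_eq_imp_space_eq[OF sets] by simp
    finally show ?thesis using deg by auto
  qed
  interpret finite_measure ?U by (rule finite_measureI) (use zero in simp)
  have "emeasure (?U \<Otimes>\<^sub>M ?U) (space ?U \<times> space ?U) = 0"
    by (subst emeasure_pair_measure_Times) (simp_all only: zero sets.top mult_zero_left)
  then have "AE z in ?U \<Otimes>\<^sub>M ?U. False"
    by (intro AE_I[of _ _ "space ?U \<times> space ?U"]) (auto simp: space_pair_measure)
  then show ?thesis
    unfolding distance_moment_def by (intro integral_eq_zero_AE) (auto elim: eventually_mono)
qed

section \<open>The double cone over a thin rectangle\<close>

locale two_axes =
  fixes e f :: "'a::euclidean_space"
  assumes eB: "e \<in> Basis" and fB: "f \<in> Basis" and ef: "e \<noteq> f"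
begin

lemma inner_axes [simp]: "e \<bullet> e = 1" "f \<bullet> f = 1" "e \<bullet> f = 0" "f \<bullet> e = 0"
  using eB fB ef by (auto simp: inner_Basis)

lemma norm_axes [simp]: "norm e = 1" "norm f = 1"
  using eB fB by auto

definition rest :: "'a \<Rightarrow> 'a" where
  "rest v = v - (v \<bullet> e) *\<^sub>R e - (v \<bullet> f) *\<^sub>R f"

text \<open>For positive \<open>b\<close> and \<open>c\<close> this is the convex hull of the
  rectangle with half-sides 1 and \<open>c\<close> in the plane of \<open>e\<close> and
  \<open>f\<close> and of the ball of radius \<open>b\<close> in its orthogonal complement.\<close>

definition body :: "real \<Rightarrow> real \<Rightarrow> 'a set" where
  "body b c = {v. \<bar>v \<bullet> e\<bar> + norm (rest v) / b \<le> 1 \<and> \<bar>v \<bullet> f\<bar> / c + norm (rest v) / b \<le> 1}"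

text \<open>These facets share with \<open>thin_facets\<close> the ridge on which both sums are 1.
  The frontier is later estimated by subadditivity, so the overlap does no harm.\<close>

definition wide_facets :: "real \<Rightarrow> real \<Rightarrow> 'a set" where
  "wide_facets b c = {v. \<bar>v \<bullet> e\<bar> + norm (rest v) / b \<le> 1 \<and> \<bar>v \<bullet> f\<bar> / c + norm (rest v) / b = 1}"

definition thin_facets :: "real \<Rightarrow> real \<Rightarrow> 'a set" where
  "thin_facets b c = {v. \<bar>v \<bullet> e\<bar> + norm (rest v) / b = 1 \<and> \<bar>v \<bullet> f\<bar> / c + norm (rest v) / b \<le> 1}"

section \<open>Coordinates with respect to the two axes\<close>

lemma rest_add: "rest (u + v) = rest u + rest v"
  and rest_diff: "rest (u - v) = rest u - rest v"
  and rest_scaleR: "rest (r *\<^sub>R v) = r *\<^sub>R rest v"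
  and rest_minus: "rest (- v) = - rest v"
  and rest_axes [simp]: "rest e = 0" "rest f = 0" "rest 0 = 0"
  by (auto simp: rest_def algebra_simps)

lemmas rest_linear = rest_add rest_diff rest_scaleR rest_minus

lemma rest_rest [simp]: "rest (rest v) = rest v"
  and rest_inner [simp]: "rest v \<bullet> e = 0" "rest v \<bullet> f = 0"
  by (auto simp: rest_def inner_diff_left inner_add_left)

lemma decompose: "v = (v \<bullet> e) *\<^sub>R e + (v \<bullet> f) *\<^sub>R f + rest v"
  by (simp add: rest_def)

lemma norm_rest_le: "norm (rest v) \<le> norm v"
proof -
  have "v \<bullet> v = (v \<bullet> e)\<^sup>2 + (v \<bullet> f)\<^sup>2 + rest v \<bullet> rest v"
    by (simp add: rest_def inner_commute power2_eq_square algebra_simps)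
  then have "rest v \<bullet> rest v \<le> v \<bullet> v" by simp
  then show ?thesis by (simp add: norm_eq_sqrt_inner)
qed

lemma abs_inner_axes_le: "\<bar>v \<bullet> e\<bar> \<le> norm v" "\<bar>v \<bullet> f\<bar> \<le> norm v"
  using Basis_le_norm eB fB by auto

lemma norm_le_coords: "norm v \<le> \<bar>v \<bullet> e\<bar> + \<bar>v \<bullet> f\<bar> + norm (rest v)"
proof -
  have "norm v = norm ((v \<bullet> e) *\<^sub>R e + (v \<bullet> f) *\<^sub>R f + rest v)" using decompose by simp
  also have "\<dots> \<le> norm ((v \<bullet> e) *\<^sub>R e) + norm ((v \<bullet> f) *\<^sub>R f) + norm (rest v)"
    by (meson norm_triangle_le norm_triangle_ineq add_mono order_refl order_trans)
  finally show ?thesis by simp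
qed

lemma continuous_on_rest [continuous_intros]:
  "continuous_on S g \<Longrightarrow> continuous_on S (\<lambda>x. rest (g x))"
  unfolding rest_def by (intro continuous_intros)

section \<open>The body and its frontier\<close>

lemma closed_body: "closed (body b c)"
  and closed_wide_facets: "closed (wide_facets b c)"
  and closed_thin_facets: "closed (thin_facets b c)"
  unfolding body_def wide_facets_def thin_facets_def divide_inverse
  by (intro closed_Collect_conj closed_Collect_le closed_Collect_eq continuous_intros)+

lemma borel_parts [measurable]:
  "body b c \<in> sets borel" "wide_facets b c \<in> sets borel" "thin_facets b c \<in> sets borel"
  using closed_body closed_wide_facets closed_thin_facets by (auto intro: borel_closed)

lemma body_coords:
  assumes "v \<in> body b c" "0 < b" "0 < c"
  shows "\<bar>v \<bullet> e\<bar> \<le> 1" "\<bar>v \<bullet> f\<bar> \<le> c" "norm (rest v) \<le> b"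
proof -
  have *: "0 \<le> norm (rest v) / b" "0 \<le> \<bar>v \<bullet> f\<bar> / c" using assms by auto
  show "\<bar>v \<bullet> e\<bar> \<le> 1" using assms(1) * unfolding body_def mem_Collect_eq by linarith
  have "\<bar>v \<bullet> f\<bar> / c \<le> 1" using assms(1) * unfolding body_def mem_Collect_eq by linarith
  then show "\<bar>v \<bullet> f\<bar> \<le> c" using assms by simp
  have "norm (rest v) / b \<le> 1" using assms(1) * unfolding body_def mem_Collect_eq by linarith
  then show "norm (rest v) \<le> b" using assms by simp
qed

lemma compact_body:
  assumes "0 < b" "0 < c"
  shows "compact (body b c)"
proof -
  have "norm v \<le> 1 + c + b" if "v \<in> body b c" for v
    using body_coords[OF that assms] norm_le_coords[of v] by linarith
  then show ?thesis
    by (intro compact_eq_bounded_closed[THEN iffD2] conjI closed_body) (auto simp: bounded_iff)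
qed

lemma minus_body [simp]: "- v \<in> body b c \<longleftrightarrow> v \<in> body b c"
  by (simp add: body_def rest_minus)

lemma scaleR_body_iff:
  "0 < r \<Longrightarrow> r *\<^sub>R v \<in> body b c \<longleftrightarrow>
    r * (\<bar>v \<bullet> e\<bar> + norm (rest v) / b) \<le> 1 \<and> r * (\<bar>v \<bullet> f\<bar> / c + norm (rest v) / b) \<le> 1"
  by (simp add: body_def rest_scaleR abs_mult distrib_left)

text \<open>Interior points satisfy both inequalities strictly, since a slightly larger multiple of
  such a point still lies in the body; conversely, the strict inequalities define an open
  set.\<close>

lemma frontier_body:
  assumes b: "0 < b" and c: "0 < c"
  shows "frontier (body b c) = wide_facets b c \<union> thin_facets b c"
proof -
  let ?I = "{v. \<bar>v \<bullet> e\<bar> + norm (rest v) / b < 1 \<and> \<bar>v \<bullet> f\<bar> / c + norm (rest v) / b < 1}"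
  have "open ?I"
    unfolding divide_inverse by (intro open_Collect_conj open_Collect_less continuous_intros)
  moreover have "?I \<subseteq> body b c" by (auto simp: body_def)
  ultimately have 1: "?I \<subseteq> interior (body b c)" by (rule interior_maximal[rotated])
  have 2: "v \<in> ?I" if v: "v \<in> interior (body b c)" for v
  proof -
    obtain r where r: "0 < r" "cball v r \<subseteq> body b c" using v by (auto simp: mem_interior_cball)
    \<comment> \<open>Small enough that \<open>(1 + t) *\<^sub>R v\<close> stays within distance
      \<open>r\<close> of \<open>v\<close>; the summand 1 covers \<open>v = 0\<close>.\<close>
    define t where "t = r / (norm v + 1)"
    have t: "0 < t" using r by (auto simp: t_def add_nonneg_pos)
    have "dist v ((1 + t) *\<^sub>R v) = t * norm v"
      using t by (simp add: dist_norm scaleR_add_left)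
    also have "\<dots> \<le> r" using r by (simp add: t_def pos_divide_le_eq add_nonneg_pos)
    finally have "(1 + t) *\<^sub>R v \<in> body b c" using r by auto
    then have *: "(1 + t) * (\<bar>v \<bullet> e\<bar> + norm (rest v) / b) \<le> 1"
      "(1 + t) * (\<bar>v \<bullet> f\<bar> / c + norm (rest v) / b) \<le> 1"
      using scaleR_body_iff[of "1 + t" v b c] t by auto
    have lt1: "x < 1" if "(1 + t) * x \<le> 1" for x
    proof (rule ccontr)
      assume "\<not> x < 1"
      then have "(1 + t) * 1 \<le> (1 + t) * x" using t by (intro mult_left_mono) auto
      from order_trans[OF this that] show False using t by simp
    qed
    show ?thesis using lt1[OF *(1)] lt1[OF *(2)] by simp
  qed
  have "interior (body b c) = ?I" using 1 2 by blast
  then show ?thesis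
    unfolding frontier_def closure_closed[OF closed_body]
    unfolding body_def wide_facets_def thin_facets_def by force
qed

lemma convex_body_body:
  assumes b: "0 < b" and c: "0 < c"
  shows "convex_body (body b c)"
proof -
  have "convex (body b c)"
  proof (rule convexI)
    fix x y :: 'a and u v :: real
    assume xy: "x \<in> body b c" "y \<in> body b c" and uv: "0 \<le> u" "0 \<le> v" "u + v = 1"
    let ?z = "u *\<^sub>R x + v *\<^sub>R y"
    have lin: "\<bar>?z \<bullet> g\<bar> \<le> u * \<bar>x \<bullet> g\<bar> + v * \<bar>y \<bullet> g\<bar>" for g
      using abs_triangle_ineq[of "u * (x \<bullet> g)" "v * (y \<bullet> g)"] uv by (simp add: inner_add_left abs_mult)
    have rst: "norm (rest ?z) \<le> u * norm (rest x) + v * norm (rest y)"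
      using norm_triangle_ineq[of "u *\<^sub>R rest x" "v *\<^sub>R rest y"] uv by (simp add: rest_linear)
    have "norm (rest ?z) / b \<le> u * (norm (rest x) / b) + v * (norm (rest y) / b)"
      using divide_right_mono[OF rst, of b] b by (simp add: add_divide_distrib)
    moreover have "\<bar>?z \<bullet> f\<bar> / c \<le> u * (\<bar>x \<bullet> f\<bar> / c) + v * (\<bar>y \<bullet> f\<bar> / c)"
      using divide_right_mono[OF lin[of f], of c] c by (simp add: add_divide_distrib)
    moreover have "u * (\<bar>x \<bullet> e\<bar> + norm (rest x) / b) + v * (\<bar>y \<bullet> e\<bar> + norm (rest y) / b) \<le> 1"
      "u * (\<bar>x \<bullet> f\<bar> / c + norm (rest x) / b) + v * (\<bar>y \<bullet> f\<bar> / c + norm (rest y) / b) \<le> 1"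
      using xy unfolding body_def by (blast intro: convex_bound_le[OF _ _ uv])+
    ultimately show "?z \<in> body b c"
      using lin[of e] uv unfolding body_def by (simp add: distrib_left)
  qed
  moreover have "interior (body b c) \<noteq> {}"
  proof -
    have "0 \<in> body b c" by (simp add: body_def)
    moreover have "0 \<notin> frontier (body b c)"
      unfolding frontier_body[OF b c] by (simp add: wide_facets_def thin_facets_def)
    ultimately show ?thesis unfolding frontier_def closure_closed[OF closed_body] by blast
  qed
  ultimately show ?thesis using compact_body[OF b c] by (simp add: convex_body_def)
qed

lemma centrally_symmetric_body: "centrally_symmetric (body b c)"
  unfolding centrally_symmetric_def
proof (rule exI[of _ 0])
  have "body b c \<subseteq> (\<lambda>x. 2 *\<^sub>R 0 - x) ` body b c"
  proof
    fix v assume "v \<in> body b c"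
    then show "v \<in> (\<lambda>x. 2 *\<^sub>R 0 - x) ` body b c"
      by (intro image_eqI[of _ _ "- v"]) simp_all
  qed
  moreover have "(\<lambda>x. 2 *\<^sub>R 0 - x) ` body b c \<subseteq> body b c"
    by (rule image_subsetI) simp
  ultimately show "(\<lambda>x. 2 *\<^sub>R 0 - x) ` body b c = body b c" by blast
qed

section \<open>The boundary law\<close>

text \<open>On each of the four pieces given by the signs along \<open>e\<close> and
  \<open>f\<close>, the tail is covered by the image of the whole piece under a homothety of ratio
  \<open>1 - s\<close> centred at a corner of the rectangle.\<close>

lemma emeasure_wide_facets_tail:
  assumes b: "0 < b" and c: "0 < c" and s: "0 \<le> s" "s < 1"
  shows "emeasure (hausdorff_measure k) (wide_facets b c \<inter> {v. s < \<bar>v \<bullet> e\<bar>})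
    \<le> ennreal ((1 - s) ^ k) * emeasure (hausdorff_measure k) (wide_facets b c)"
proof -
  let ?H = "emeasure (hausdorff_measure k :: 'a measure)"
  define piece where
    "piece r z = wide_facets b c \<inter> {v. r < fst z * (v \<bullet> e)} \<inter> {v. 0 < snd z * (v \<bullet> f)}" for r and z :: "real \<times> real"
  define I where "I = {1, -1 :: real} \<times> {1, -1 :: real}"
  have I: "finite I" by (simp add: I_def)
  have [measurable]: "piece r z \<in> sets borel" for r z
    unfolding piece_def by measurable
  have contract: "?H (piece s z) \<le> ennreal ((1 - s) ^ k) * ?H (piece 0 z)" if "z \<in> I" for z
  proof -
    obtain \<sigma> \<tau> where z: "z = (\<sigma>, \<tau>)" by (cases z)
    then have st: "\<bar>\<sigma>\<bar> = 1" "\<bar>\<tau>\<bar> = 1" "\<sigma> * \<sigma> = 1" "\<tau> * \<tau> = 1"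
      using that by (auto simp: I_def)
    show ?thesis
    proof (rule emeasure_hausdorff_measure_lipschitz_le)
      \<comment> \<open>The homothety with ratio \<open>1 - s\<close> fixing \<open>w\<close> maps the piece \<open>t > 0\<close> onto the piece \<open>t > s\<close>.\<close>
      define w where "w = \<sigma> *\<^sub>R e + (\<tau> * c) *\<^sub>R f"
      let ?\<phi> = "\<lambda>u. s *\<^sub>R w + (1 - s) *\<^sub>R u"
      show "dist (?\<phi> x) (?\<phi> y) \<le> (1 - s) * dist x y" for x y
      proof -
        have "?\<phi> x - ?\<phi> y = (1 - s) *\<^sub>R (x - y)" by (simp add: algebra_simps)
        then show ?thesis using s by (simp add: dist_norm)
      qed
      show "piece s z \<subseteq> ?\<phi> ` piece 0 z"
      proof
        fix v assume v: "v \<in> piece s z"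
        define u where "u = (1 / (1 - s)) *\<^sub>R (v - s *\<^sub>R w)"
        have vu: "v = ?\<phi> u" using s by (simp add: u_def)
        have "u \<bullet> e = (v \<bullet> e - s * \<sigma>) / (1 - s)"
          by (simp add: u_def w_def inner_diff_left inner_add_left mult_ac)
        then have "\<sigma> * (u \<bullet> e) = (\<sigma> * (v \<bullet> e) - s * (\<sigma> * \<sigma>)) / (1 - s)"
          by (simp add: algebra_simps)
        then have ue: "\<sigma> * (u \<bullet> e) = (\<sigma> * (v \<bullet> e) - s) / (1 - s)"
          by (simp add: st)
        have "u \<bullet> f = (v \<bullet> f - s * c * \<tau>) / (1 - s)"
          by (simp add: u_def w_def inner_diff_left inner_add_left mult_ac)
        then have "\<tau> * (u \<bullet> f) = (\<tau> * (v \<bullet> f) - s * c * (\<tau> * \<tau>)) / (1 - s)"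
          by (simp add: algebra_simps)
        then have uf: "\<tau> * (u \<bullet> f) = (\<tau> * (v \<bullet> f) - s * c) / (1 - s)"
          by (simp add: st)
        have ur: "norm (rest u) = norm (rest v) / (1 - s)"
          using s by (simp add: u_def w_def rest_linear)
        have sgn: "\<bar>x\<bar> = \<sigma> * x" if "0 < \<sigma> * x" for x
          using that st by (metis abs_mult abs_of_pos mult_1)
        have sgn': "\<bar>x\<bar> = \<tau> * x" if "0 < \<tau> * x" for x
          using that st by (metis abs_mult abs_of_pos mult_1)
        have p: "s < \<sigma> * (v \<bullet> e)" "0 < \<tau> * (v \<bullet> f)" using v by (auto simp: piece_def z)
        have w1: "\<sigma> * (v \<bullet> e) + norm (rest v) / b \<le> 1" "\<tau> * (v \<bullet> f) / c + norm (rest v) / b = 1"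
          using v sgn[of "v \<bullet> e"] sgn'[of "v \<bullet> f"] p s by (auto simp: piece_def wide_facets_def)
        have ue_pos: "0 < \<sigma> * (u \<bullet> e)" using p s by (simp add: ue)
        \<comment> \<open>On a wide facet \<open>\<tau> * (v \<bullet> f) / c\<close> equals
          \<open>1 - norm (rest v) / b\<close>, which is at least
          \<open>\<sigma> * (v \<bullet> e)\<close>; hence the preimage \<open>u\<close> keeps its
          sign along \<open>f\<close>.\<close>
        have "s < \<tau> * (v \<bullet> f) / c" using w1 p by linarith
        then have "s * c < \<tau> * (v \<bullet> f)" using c by (simp add: field_simps)
        then have uf_pos: "0 < \<tau> * (u \<bullet> f)" using s by (simp add: uf)
        have "\<sigma> * (u \<bullet> e) + norm (rest u) / b = (\<sigma> * (v \<bullet> e) + norm (rest v) / b - s) / (1 - s)"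
          unfolding ue ur by (simp add: add_divide_distrib diff_divide_distrib)
        also have "\<dots> \<le> (1 - s) / (1 - s)" using w1 s by (intro divide_right_mono) auto
        finally have u1: "\<sigma> * (u \<bullet> e) + norm (rest u) / b \<le> 1" using s by simp
        have "\<tau> * (u \<bullet> f) / c + norm (rest u) / b = (\<tau> * (v \<bullet> f) / c + norm (rest v) / b - s) / (1 - s)"
          unfolding uf ur using c by (simp add: add_divide_distrib diff_divide_distrib mult.commute)
        also have "\<dots> = 1" using w1 s by simp
        finally have u2: "\<tau> * (u \<bullet> f) / c + norm (rest u) / b = 1" .
        have "u \<in> piece 0 z"
          using u1 u2 ue_pos uf_pos sgn[OF ue_pos] sgn'[OF uf_pos]
          by (simp add: piece_def z wide_facets_def)
        with vu show "v \<in> ?\<phi> ` piece 0 z" by blast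
      qed
    qed (use s in auto)
  qed
  have sgn_self: "sgn x * x = \<bar>x\<bar>" for x :: real by (simp add: sgn_if)
  have "?H (wide_facets b c \<inter> {v. s < \<bar>v \<bullet> e\<bar>}) \<le> ?H (\<Union>z\<in>I. piece s z)"
  proof (rule emeasure_mono)
    show "wide_facets b c \<inter> {v. s < \<bar>v \<bullet> e\<bar>} \<subseteq> (\<Union>z\<in>I. piece s z)"
    proof
      fix v assume v: "v \<in> wide_facets b c \<inter> {v. s < \<bar>v \<bullet> e\<bar>}"
      then have "\<bar>v \<bullet> f\<bar> / c > 0" using s by (auto simp: wide_facets_def)
      then have "v \<bullet> f \<noteq> 0" by auto
      then have "v \<in> piece s (sgn (v \<bullet> e), sgn (v \<bullet> f))"
        using v by (simp add: piece_def sgn_self)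
      moreover have "(sgn (v \<bullet> e), sgn (v \<bullet> f)) \<in> I"
        using v s \<open>v \<bullet> f \<noteq> 0\<close> by (auto simp: I_def sgn_if)
      ultimately show "v \<in> (\<Union>z\<in>I. piece s z)" by blast
    qed
  qed (use I in auto)
  also have "\<dots> \<le> (\<Sum>z\<in>I. ?H (piece s z))"
    using I by (intro emeasure_subadditive_finite) auto
  also have "\<dots> \<le> (\<Sum>z\<in>I. ennreal ((1 - s) ^ k) * ?H (piece 0 z))"
    using contract by (rule sum_mono)
  also have "\<dots> = ennreal ((1 - s) ^ k) * ?H (\<Union>z\<in>I. piece 0 z)"
  proof -
    have "disjoint_family_on (piece 0) I"
      unfolding disjoint_family_on_def piece_def I_def by (auto simp: mult_less_0_iff)
    then have "(\<Sum>z\<in>I. ?H (piece 0 z)) = ?H (\<Union>z\<in>I. piece 0 z)"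
      using I by (intro sum_emeasure) auto
    then show ?thesis by (simp add: sum_distrib_left[symmetric])
  qed
  also have "\<dots> \<le> ennreal ((1 - s) ^ k) * ?H (wide_facets b c)"
    by (intro mult_left_mono emeasure_mono) (auto simp: piece_def)
  finally show ?thesis .
qed

text \<open>
  The thin facets have width at most \<open>2 * c\<close> in direction \<open>f\<close>, so \<open>N\<close> disjoint translates of them fit into the
  set \<open>W 1 \<union> W (- 1)\<close>, which is a Lipschitz image of a dilate of a projection of the wide facets.
\<close>

lemma emeasure_thin_facets_le:
  assumes b: "0 < b" and c: "0 < c" and N: "3 * c * real N \<le> 1"
  shows "of_nat N * emeasure (hausdorff_measure k) (thin_facets b c)
    \<le> ennreal (2 * (2 * (2 + 1 / b)) ^ k) * emeasure (hausdorff_measure k) (wide_facets b c)"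
proof -
  let ?H = "emeasure (hausdorff_measure k :: 'a measure)"
  \<comment> \<open>A Lipschitz constant for the parametrisation of \<open>W \<sigma>\<close> over
    \<open>R 2\<close>: 1 for the coordinate along \<open>f\<close>, 1 for \<open>rest\<close>, and
    \<open>1 / b\<close> for the height along \<open>e\<close>.\<close>
  define L where "L = 2 + 1 / b"
  have L: "0 < L" using b by (simp add: L_def add_pos_pos)
  \<comment> \<open>\<open>R 1\<close> is the projection of the wide facets along \<open>f\<close>,
    and \<open>R 2\<close> its dilate by 2.\<close>
  define R where "R r = {v. v \<bullet> f = 0 \<and> \<bar>v \<bullet> e\<bar> + norm (rest v) / b \<le> r}" for r
  \<comment> \<open>The hypersurface carrying the thin facets on the side \<open>\<sigma>\<close>,
    prolonged in direction \<open>f\<close> to make room for the translates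
    \<open>B j\<close>.\<close>
  define W where "W \<sigma> = {v. v \<bullet> e = \<sigma> * (1 - norm (rest v) / b) \<and> \<bar>v \<bullet> f\<bar> \<le> 1 \<and> norm (rest v) / b \<le> 1}" for \<sigma> :: real
  define B where "B j = {v. v - (3 * c * real j) *\<^sub>R f \<in> thin_facets b c}" for j :: nat
  have [measurable]: "R r \<in> sets borel" for r
    unfolding R_def divide_inverse
    by (intro borel_closed closed_Collect_conj closed_Collect_le closed_Collect_eq continuous_intros)
  have [measurable]: "W r \<in> sets borel" for r
    unfolding W_def divide_inverse
    by (intro borel_closed closed_Collect_conj closed_Collect_le closed_Collect_eq continuous_intros)
  have [measurable]: "B j \<in> sets borel" for j
  proof -
    have "closed ((\<lambda>v. v - (3 * c * real j) *\<^sub>R f) -` thin_facets b c)"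
      by (intro closed_vimage closed_thin_facets continuous_intros)
    then show ?thesis by (intro borel_closed) (simp add: B_def vimage_def)
  qed
  have 1: "?H (R 1) \<le> ?H (wide_facets b c)"
  proof -
    have "?H (R 1) \<le> ennreal (1 ^ k) * ?H (wide_facets b c)"
    proof (rule emeasure_hausdorff_measure_lipschitz_le)
      let ?\<pi> = "\<lambda>v. v - (v \<bullet> f) *\<^sub>R f"
      show "dist (?\<pi> x) (?\<pi> y) \<le> 1 * dist x y" for x y
      proof -
        have eq: "?\<pi> x - ?\<pi> y = ?\<pi> (x - y)" by (simp add: algebra_simps)
        have "?\<pi> d \<bullet> ?\<pi> d = d \<bullet> d - (d \<bullet> f)\<^sup>2" for d
          by (simp add: algebra_simps inner_commute power2_eq_square)
        then have "norm (?\<pi> d) \<le> norm d" for d by (simp add: norm_eq_sqrt_inner)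
        then show ?thesis by (simp only: dist_norm eq mult_1)
      qed
      show "R 1 \<subseteq> ?\<pi> ` wide_facets b c"
      proof
        fix v assume v: "v \<in> R 1"
        let ?t = "1 - norm (rest v) / b"
        have t: "0 \<le> ?t" using v by (auto simp: R_def)
        let ?u = "v + (c * ?t) *\<^sub>R f"
        have "?u \<in> wide_facets b c"
          using v c t by (simp add: wide_facets_def R_def rest_linear inner_add_left abs_mult)
        moreover have "v = ?\<pi> ?u"
          using v by (simp add: R_def inner_add_left)
        ultimately show "v \<in> ?\<pi> ` wide_facets b c" by (intro image_eqI)
      qed
    qed auto
    then show ?thesis by simp
  qed
  have 2: "?H (R 2) \<le> ennreal (2 ^ k) * ?H (R 1)"
  proof (rule emeasure_hausdorff_measure_lipschitz_le)
    show "dist (2 *\<^sub>R x) (2 *\<^sub>R y) \<le> 2 * dist x y" for x y :: 'a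
    proof -
      have "2 *\<^sub>R x - 2 *\<^sub>R y = 2 *\<^sub>R (x - y)" by (simp add: scaleR_diff_right)
      then show ?thesis by (simp add: dist_norm)
    qed
    show "R 2 \<subseteq> (*\<^sub>R) 2 ` R 1"
    proof
      fix v assume v: "v \<in> R 2"
      then have "(1 / 2) *\<^sub>R v \<in> R 1"
        by (simp add: R_def rest_scaleR abs_mult)
      then show "v \<in> (*\<^sub>R) 2 ` R 1"
        by (intro image_eqI[of _ _ "(1 / 2) *\<^sub>R v"]) simp_all
    qed
  qed auto
  have 3: "?H (W \<sigma>) \<le> ennreal (L ^ k) * ?H (R 2)" if \<sigma>: "\<bar>\<sigma>\<bar> = 1" for \<sigma>
  proof (rule emeasure_hausdorff_measure_lipschitz_le)
    \<comment> \<open>The coordinate of \<open>R 2\<close> along \<open>e\<close> becomes the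
      position along \<open>f\<close>, and the new coordinate along \<open>e\<close> is the height
      of the graph. On \<open>W \<sigma>\<close> both \<open>\<bar>v \<bullet> f\<bar>\<close> and
      \<open>norm (rest v) / b\<close> range up to 1, so their sum may reach 2; this is why
      \<open>R 2\<close> is the domain.\<close>
    let ?\<psi> = "\<lambda>v. rest v + (v \<bullet> e) *\<^sub>R f + (\<sigma> * (1 - norm (rest v) / b)) *\<^sub>R e"
    show "dist (?\<psi> x) (?\<psi> y) \<le> L * dist x y" for x y
    proof -
      let ?D = "?\<psi> x - ?\<psi> y"
      have "?D \<bullet> e = - (\<sigma> * ((norm (rest x) - norm (rest y)) / b))"
        by (simp add: inner_diff_left inner_add_left diff_divide_distrib algebra_simps)
      then have "\<bar>?D \<bullet> e\<bar> = \<bar>norm (rest x) - norm (rest y)\<bar> / b"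
        using \<sigma> b by (simp add: abs_mult)
      also have "\<dots> \<le> norm (x - y) / b"
        using norm_triangle_ineq3[of "rest x" "rest y"] norm_rest_le[of "x - y"] b
        by (intro divide_right_mono) (auto simp: rest_diff)
      finally have "\<bar>?D \<bullet> e\<bar> \<le> norm (x - y) / b" .
      moreover have "?D \<bullet> f = (x - y) \<bullet> e"
        by (simp add: inner_diff_left inner_add_left)
      then have "\<bar>?D \<bullet> f\<bar> \<le> norm (x - y)" using abs_inner_axes_le(1)[of "x - y"] by simp
      moreover have "rest ?D = rest (x - y)" by (simp add: rest_linear)
      then have "norm (rest ?D) \<le> norm (x - y)" using norm_rest_le[of "x - y"] by simp
      ultimately have "norm ?D \<le> norm (x - y) / b + norm (x - y) + norm (x - y)"
        using norm_le_coords[of ?D] by linarith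
      then show ?thesis by (simp add: L_def dist_norm algebra_simps)
    qed
    show "W \<sigma> \<subseteq> ?\<psi> ` R 2"
    proof
      fix v assume v: "v \<in> W \<sigma>"
      let ?u = "rest v + (v \<bullet> f) *\<^sub>R e"
      have "?u \<in> R 2"
        using v by (simp add: W_def R_def rest_linear inner_add_left)
      moreover have "?\<psi> ?u = (v \<bullet> e) *\<^sub>R e + (v \<bullet> f) *\<^sub>R f + rest v"
        using v by (simp add: W_def rest_linear inner_add_left add_ac)
      then have "v = ?\<psi> ?u" using decompose[of v] by (simp only:)
      ultimately show "v \<in> ?\<psi> ` R 2" by (intro image_eqI)
    qed
  qed (use L in auto)
  have 4: "?H (thin_facets b c) \<le> ?H (B j)" for j
  proof -
    have "?H (thin_facets b c) \<le> ennreal (1 ^ k) * ?H (B j)"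
    proof (rule emeasure_hausdorff_measure_lipschitz_le)
      let ?t = "(3 * c * real j) *\<^sub>R f"
      show "thin_facets b c \<subseteq> (\<lambda>v. v - ?t) ` B j"
        by (rule subsetI, rule_tac x = "x + ?t" in image_eqI) (simp_all add: B_def)
    qed (auto simp: dist_norm)
    then show ?thesis by simp
  qed
  have thin_f: "\<bar>v \<bullet> f\<bar> \<le> c" "norm (rest v) / b \<le> 1"
    "v \<bullet> e = 1 - norm (rest v) / b \<or> v \<bullet> e = - (1 - norm (rest v) / b)" if "v \<in> thin_facets b c" for v
  proof -
    have "v \<in> body b c" using that by (simp add: thin_facets_def body_def)
    then show "\<bar>v \<bullet> f\<bar> \<le> c" using body_coords b c by blast
    have *: "\<bar>v \<bullet> e\<bar> + norm (rest v) / b = 1" using that by (simp add: thin_facets_def)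
    then show "norm (rest v) / b \<le> 1" by linarith
    from * show "v \<bullet> e = 1 - norm (rest v) / b \<or> v \<bullet> e = - (1 - norm (rest v) / b)" by linarith
  qed
  have Bf: "\<bar>v \<bullet> f - 3 * c * real j\<bar> \<le> c" if "v \<in> B j" for v j
    using thin_f(1)[of "v - (3 * c * real j) *\<^sub>R f"] that by (simp add: B_def inner_diff_left)
  have "of_nat N * ?H (thin_facets b c) = (\<Sum>j<N. ?H (thin_facets b c))" by simp
  also have "\<dots> \<le> (\<Sum>j<N. ?H (B j))" by (intro sum_mono 4)
  also have "\<dots> = ?H (\<Union>j<N. B j)"
  proof (rule sum_emeasure)
    \<comment> \<open>The translates are spaced by \<open>3 * c\<close> and at most
      \<open>2 * c\<close> wide, hence disjoint.\<close>
    have "i = j" if "v \<in> B i" "v \<in> B j" for v i j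
    proof -
      have "\<bar>3 * c * real i - 3 * c * real j\<bar> \<le> 2 * c"
        using Bf[OF that(1)] Bf[OF that(2)] by linarith
      also have "3 * c * real i - 3 * c * real j = c * (3 * (real i - real j))" by (simp add: algebra_simps)
      finally have "c * \<bar>3 * (real i - real j)\<bar> \<le> c * 2" using c by (simp add: abs_mult)
      then have "\<bar>3 * (real i - real j)\<bar> \<le> 2" using c by (simp only: mult_le_cancel_left_pos)
      then have "real i < real (Suc j)" "real j < real (Suc i)" by (auto simp: abs_le_iff)
      then show ?thesis unfolding of_nat_less_iff by simp
    qed
    then show "disjoint_family_on B {..<N}"
      unfolding disjoint_family_on_def by blast
  qed auto
  also have "\<dots> \<le> ?H (W 1 \<union> W (- 1))"
  proof (rule emeasure_mono)
    show "(\<Union>j<N. B j) \<subseteq> W 1 \<union> W (- 1)"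
    proof
      fix v assume "v \<in> (\<Union>j<N. B j)"
      then obtain j where j: "j < N" "v \<in> B j" by auto
      let ?u = "v - (3 * c * real j) *\<^sub>R f"
      have "rest ?u = rest v" "?u \<bullet> e = v \<bullet> e"
        by (simp_all add: rest_linear inner_diff_left)
      moreover have "?u \<in> thin_facets b c" using j by (simp add: B_def)
      \<comment> \<open>The last translate reaches at most \<open>3 * c * (N - 1) + c\<close>, which
        is below \<open>3 * c * N\<close>.\<close>
      moreover have "\<bar>v \<bullet> f\<bar> \<le> 1"
      proof -
        have "3 * c * real (Suc j) \<le> 3 * c * real N"
          using j c by (intro mult_left_mono) (simp_all add: Suc_le_eq del: of_nat_Suc)
        then have "3 * c * real j + 3 * c \<le> 3 * c * real N" by (simp add: algebra_simps)
        moreover have "0 \<le> 3 * c * real j" using c by simp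
        ultimately show ?thesis using Bf[OF j(2)] N c by linarith
      qed
      ultimately show "v \<in> W 1 \<union> W (- 1)"
        using thin_f(2,3)[of ?u] by (auto simp: W_def)
    qed
  qed auto
  also have "\<dots> \<le> ?H (W 1) + ?H (W (- 1))"
    by (rule emeasure_subadditive) auto
  also have "\<dots> \<le> ennreal (L ^ k) * ?H (R 2) + ennreal (L ^ k) * ?H (R 2)"
    by (intro add_mono 3) auto
  also have "\<dots> = ennreal (2 * L ^ k) * ?H (R 2)"
  proof -
    have "ennreal (2 * L ^ k) = ennreal (L ^ k) + ennreal (L ^ k)"
      using L by (subst ennreal_plus[symmetric]) auto
    then show ?thesis by (simp only: distrib_right)
  qed
  also have "\<dots> \<le> ennreal (2 * L ^ k) * (ennreal (2 ^ k) * ?H (wide_facets b c))"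
    by (rule mult_left_mono[OF order_trans[OF 2 mult_left_mono[OF 1]]]) simp_all
  also have "\<dots> = ennreal (2 * (2 * L) ^ k) * ?H (wide_facets b c)"
  proof -
    have "2 * (2 * L) ^ k = 2 * L ^ k * 2 ^ k" by (simp add: power_mult_distrib)
    then show ?thesis using L by (simp only:) (subst ennreal_mult, auto simp: mult.assoc)
  qed
  finally show ?thesis by (simp add: L_def)
qed

section \<open>The interior law\<close>

text \<open>Up to translation \<open>T\<close> is diagonal in the standard basis, with entry
  \<open>\<gamma>\<close> in the \<open>DIM('a) - 2\<close> directions other than \<open>e\<close>
  and \<open>f\<close>; the factor is its absolute determinant.\<close>

lemma measure_lborel_stretch:
  fixes t :: 'a and \<alpha> \<beta> \<gamma> :: real
  assumes nz: "\<alpha> \<noteq> 0" "\<beta> \<noteq> 0" "\<gamma> \<noteq> 0" and A [measurable]: "A \<in> sets borel"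
  defines "T v \<equiv> t + (\<alpha> * (v \<bullet> e)) *\<^sub>R e + (\<beta> * (v \<bullet> f)) *\<^sub>R f + \<gamma> *\<^sub>R rest v"
  shows "measure lborel A = \<bar>\<alpha>\<bar> * \<bar>\<beta>\<bar> * \<bar>\<gamma>\<bar> ^ (DIM('a) - 2) * measure lborel {v. T v \<in> A}"
proof -
  define c where "c j = (if j = e then \<alpha> else if j = f then \<beta> else \<gamma>)" for j
  have T: "T v = t + (\<Sum>j\<in>Basis. (c j * (v \<bullet> j)) *\<^sub>R j)" for v
  proof -
    have "(\<Sum>j\<in>Basis. (c j * (v \<bullet> j)) *\<^sub>R j) = (\<Sum>j\<in>Basis. \<gamma> *\<^sub>R (v \<bullet> j) *\<^sub>R j
        + ((if j = e then ((\<alpha> - \<gamma>) * (v \<bullet> e)) *\<^sub>R e else 0)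
        + (if j = f then ((\<beta> - \<gamma>) * (v \<bullet> f)) *\<^sub>R f else 0)))"
      using ef by (intro sum.cong) (auto simp: c_def algebra_simps)
    also have "\<dots> = \<gamma> *\<^sub>R v + (((\<alpha> - \<gamma>) * (v \<bullet> e)) *\<^sub>R e + ((\<beta> - \<gamma>) * (v \<bullet> f)) *\<^sub>R f)"
      using eB fB
      by (simp add: sum.distrib scaleR_sum_right[symmetric] euclidean_representation del: scaleR_scaleR)
    finally show ?thesis by (simp add: T_def rest_def algebra_simps)
  qed
  have prod: "(\<Prod>j\<in>Basis. \<bar>c j\<bar>) = \<bar>\<alpha>\<bar> * \<bar>\<beta>\<bar> * \<bar>\<gamma>\<bar> ^ (DIM('a) - 2)"
  proof -
    have "(\<Prod>j\<in>Basis. \<bar>c j\<bar>) = \<bar>c e\<bar> * (\<bar>c f\<bar> * (\<Prod>j\<in>Basis - {e} - {f}. \<bar>c j\<bar>))"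
      using eB fB ef by (subst prod.remove[of _ e], simp, simp, subst prod.remove[of _ f]) auto
    also have "(\<Prod>j\<in>Basis - {e} - {f}. \<bar>c j\<bar>) = (\<Prod>j\<in>Basis - {e} - {f}. \<bar>\<gamma>\<bar>)"
      by (intro prod.cong) (auto simp: c_def)
    also have "\<dots> = \<bar>\<gamma>\<bar> ^ (DIM('a) - 2)"
      using eB fB ef by (simp add: card_Diff_singleton_if numeral_2_eq_2)
    finally show ?thesis using ef by (simp add: c_def)
  qed
  let ?C = "\<bar>\<alpha>\<bar> * \<bar>\<beta>\<bar> * \<bar>\<gamma>\<bar> ^ (DIM('a) - 2)"
  have [measurable]: "T \<in> borel \<rightarrow>\<^sub>M borel"
    unfolding T by measurable
  have "c j \<noteq> 0" for j using nz by (simp add: c_def)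
  from lborel_affine_euclidean[of c t, OF this]
  have "(lborel :: 'a measure) = density (distr lborel borel T) (\<lambda>_. ?C)"
    by (simp only: prod T[symmetric])
  then have "emeasure lborel A = emeasure (density (distr lborel borel T) (\<lambda>_. ?C)) A"
    by simp
  also have "\<dots> = ennreal ?C * emeasure (distr lborel borel T) A"
    by (simp add: emeasure_density_const)
  also have "\<dots> = ennreal ?C * emeasure lborel {v. T v \<in> A}"
    by (simp add: emeasure_distr vimage_def)
  finally show ?thesis
    by (simp add: measure_def enn2real_mult)
qed

text \<open>Stretching by \<open>c\<close> along \<open>f\<close> and by \<open>b\<close> on
  \<open>rest\<close> carries \<open>body 1 1\<close> to \<open>body b c\<close> and fixes the
  coordinate along \<open>e\<close>.\<close>

lemma measure_body_stretch:
  assumes b: "0 < b" and c: "0 < c" and [measurable]: "X \<in> sets borel"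
  shows "measure lborel (body b c \<inter> {v. v \<bullet> e \<in> X})
    = c * b ^ (DIM('a) - 2) * measure lborel (body 1 1 \<inter> {v. v \<bullet> e \<in> X})"
proof -
  have "body b c \<inter> {v. v \<bullet> e \<in> X} \<in> sets borel" by measurable
  note measure_lborel_stretch[OF _ _ _ this, of 1 c b 0]
  moreover have "{v. 0 + (1 * (v \<bullet> e)) *\<^sub>R e + (c * (v \<bullet> f)) *\<^sub>R f + b *\<^sub>R rest v \<in> body b c \<inter> {v. v \<bullet> e \<in> X}}
      = body 1 1 \<inter> {v. v \<bullet> e \<in> X}"
    using b c by (auto simp: body_def rest_linear inner_add_left abs_mult)
  ultimately show ?thesis using b c by simp
qed

lemma measure_open_pos:
  assumes "open U" "U \<noteq> {}" "bounded U"
  shows "0 < measure lborel (U :: 'a set)"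
proof -
  have "U \<notin> null_sets lebesgue"
    using open_not_negligible[OF assms(1,2)] by (simp add: negligible_iff_null_sets)
  then have "emeasure lborel U \<noteq> 0"
    using assms(1) by (auto simp: null_sets_def)
  moreover have "emeasure lborel U < \<infinity>" using assms by (intro emeasure_bounded_finite)
  ultimately show ?thesis
    by (simp add: measure_def enn2real_positive_iff zero_less_iff_neq_zero)
qed

lemma emeasure_body:
  assumes "0 < b" "0 < c"
  shows "emeasure lborel (body b c) \<noteq> 0" "emeasure lborel (body b c) \<noteq> \<infinity>"
proof -
  show fin: "emeasure lborel (body b c) \<noteq> \<infinity>"
    using emeasure_compact_finite[OF compact_body[OF assms]] by simp
  have "0 < measure lborel (interior (body b c))"
    using convex_body_body[OF assms] bounded_subset[OF compact_imp_bounded[OF compact_body[OF assms]] interior_subset]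
    by (intro measure_open_pos) (auto simp: convex_body_def)
  then have "0 < emeasure lborel (interior (body b c))"
    by (simp add: measure_def enn2real_positive_iff)
  also have "\<dots> \<le> emeasure lborel (body b c)"
    by (intro emeasure_mono interior_subset) auto
  finally show "emeasure lborel (body b c) \<noteq> 0" by simp
qed

section \<open>The law of the coordinate along the long axis\<close>

definition interior_law :: "real \<Rightarrow> real \<Rightarrow> real measure" where
  "interior_law b c = distr (uniform_measure lborel (body b c)) borel (\<lambda>v. \<bar>v \<bullet> e\<bar>)"

lemma prob_space_uniform_body:
  "0 < b \<Longrightarrow> 0 < c \<Longrightarrow> prob_space (uniform_measure lborel (body b c))"
  using emeasure_body by (intro prob_space_uniform_measure)

lemma prob_space_interior_law: "0 < b \<Longrightarrow> 0 < c \<Longrightarrow> prob_space (interior_law b c)"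
  unfolding interior_law_def
  by (intro prob_space.prob_space_distr prob_space_uniform_body) auto

lemma sets_interior_law [measurable_cong, simp]: "sets (interior_law b c) = sets borel"
  by (simp add: interior_law_def)

lemma AE_interior_law:
  assumes "0 < b" "0 < c"
  shows "AE x in interior_law b c. 0 \<le> x \<and> x \<le> 1"
proof -
  have "AE v in uniform_measure lborel (body b c). 0 \<le> \<bar>v \<bullet> e\<bar> \<and> \<bar>v \<bullet> e\<bar> \<le> 1"
    by (rule AE_uniform_measureI, simp, rule AE_I2) (use body_coords(1)[OF _ assms] in simp)
  then show ?thesis
    unfolding interior_law_def by (subst AE_distr_iff) auto
qed

lemma measure_interior_law:
  assumes "0 < b" "0 < c" and X [measurable]: "X \<in> sets borel"
  shows "measure (interior_law b c) X = measure lborel (body b c \<inter> {v. \<bar>v \<bullet> e\<bar> \<in> X}) / measure lborel (body b c)"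
proof -
  have "measure (interior_law b c) X = measure (uniform_measure lborel (body b c)) {v. \<bar>v \<bullet> e\<bar> \<in> X}"
    unfolding interior_law_def by (subst measure_distr) (auto simp: vimage_def)
  also have "\<dots> = measure lborel (body b c \<inter> {v. \<bar>v \<bullet> e\<bar> \<in> X}) / measure lborel (body b c)"
    by (rule measure_uniform_measure) (use emeasure_body[OF assms(1,2)] in auto)
  finally show ?thesis .
qed

text \<open>Numerator and denominator scale by the same factor. This independence lets the gain be
  fixed before \<open>b\<close> and \<open>c\<close> are chosen.\<close>

lemma interior_law_eq:
  assumes b: "0 < b" and c: "0 < c"
  shows "interior_law b c = interior_law 1 1"
proof (rule measure_eqI)
  interpret P: prob_space "interior_law b c" by (rule prob_space_interior_law[OF b c])
  interpret Q: prob_space "interior_law 1 1" by (rule prob_space_interior_law) auto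
  fix X assume "X \<in> sets (interior_law b c)"
  then have [measurable]: "X \<in> sets borel" by simp
  have "{x. \<bar>x\<bar> \<in> X} \<in> sets borel" by measurable
  note measure_body_stretch[OF b c this] measure_body_stretch[OF b c, of UNIV]
  then have "measure (interior_law b c) X = measure (interior_law 1 1) X"
    using b c by (simp add: measure_interior_law)
  then show "emeasure (interior_law b c) X = emeasure (interior_law 1 1) X"
    by (simp add: P.emeasure_eq_measure Q.emeasure_eq_measure)
qed simp

text \<open>Reflection in the coordinate along \<open>e\<close> exchanges the two halves.\<close>

lemma measure_body_half:
  assumes s: "0 \<le> s"
  shows "measure lborel (body 1 1 \<inter> {v. s < \<bar>v \<bullet> e\<bar>}) = 2 * measure lborel (body 1 1 \<inter> {v. s < v \<bullet> e})"
proof -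
  have [measurable]: "body 1 1 \<inter> {v. s < v \<bullet> e} \<in> sets borel" "body 1 1 \<inter> {v. s < - (v \<bullet> e)} \<in> sets borel"
    by measurable
  note measure_lborel_stretch[OF _ _ _ this(1), of "-1" 1 1 0]
  moreover have "{v. 0 + (- 1 * (v \<bullet> e)) *\<^sub>R e + (1 * (v \<bullet> f)) *\<^sub>R f + 1 *\<^sub>R rest v \<in> body 1 1 \<inter> {v. s < v \<bullet> e}}
      = body 1 1 \<inter> {v. s < - (v \<bullet> e)}"
    by (auto simp: body_def rest_linear inner_add_left inner_diff_left)
  ultimately have "measure lborel (body 1 1 \<inter> {v. s < - (v \<bullet> e)}) = measure lborel (body 1 1 \<inter> {v. s < v \<bullet> e})"
    by simp
  moreover have "measure lborel ((body 1 1 \<inter> {v. s < v \<bullet> e}) \<union> (body 1 1 \<inter> {v. s < - (v \<bullet> e)}))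
      = measure lborel (body 1 1 \<inter> {v. s < v \<bullet> e}) + measure lborel (body 1 1 \<inter> {v. s < - (v \<bullet> e)})"
  proof (rule measure_Union)
    have "emeasure lborel (body 1 1 \<inter> X) \<noteq> \<infinity>" for X
      using emeasure_bounded_finite[OF bounded_subset[OF compact_imp_bounded[OF compact_body[of 1 1]] Int_lower1]]
      by (simp add: less_top)
    then show "emeasure lborel (body 1 1 \<inter> {v. s < v \<bullet> e}) \<noteq> \<infinity>"
      "emeasure lborel (body 1 1 \<inter> {v. s < - (v \<bullet> e)}) \<noteq> \<infinity>" by blast+
  qed (use s in auto)
  moreover have "(body 1 1 \<inter> {v. s < v \<bullet> e}) \<union> (body 1 1 \<inter> {v. s < - (v \<bullet> e)}) = body 1 1 \<inter> {v. s < \<bar>v \<bullet> e\<bar>}"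
    by auto
  ultimately show ?thesis by simp
qed

lemma measure_body_eq: "measure lborel (body 1 1) = 2 * measure lborel (body 1 1 \<inter> {v. 0 < v \<bullet> e})"
proof -
  have "negligible {v. v \<bullet> e = 0}" using eB by blast
  then have "{v. v \<bullet> e = 0} \<in> null_sets lborel"
    by (auto simp: negligible_iff_null_sets null_sets_def)
  then have "AE v in lborel. v \<bullet> e \<noteq> 0" by (auto dest: AE_not_in)
  then have "measure lborel (body 1 1) = measure lborel (body 1 1 \<inter> {v. 0 < \<bar>v \<bullet> e\<bar>})"
    by (intro measure_eq_AE) (auto elim!: eventually_mono)
  then show ?thesis using measure_body_half[of 0] by simp
qed

text \<open>
  For \<open>s1 \<le> s\<close> the set \<open>M\<close> lies outside \<open>body 1 1\<close>, but the contraction still maps it into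
  \<open>body 1 1 \<inter> {v. s < v \<bullet> e}\<close>; this is what makes the interior law strictly more spread out.
\<close>

lemma measure_body_tail:
  fixes s s1 :: real
  defines "M \<equiv> {v. 0 < v \<bullet> e \<and> v \<bullet> e + norm (rest v) \<le> 1 \<and> 1 < \<bar>v \<bullet> f\<bar> + norm (rest v)
      \<and> \<bar>v \<bullet> f\<bar> + (1 - s1) * norm (rest v) \<le> 1}"
  assumes s: "0 \<le> s" "s < 1" and s1: "s1 < 1"
  shows "(1 - s) ^ (DIM('a) - 1) * (measure lborel (body 1 1 \<inter> {v. 0 < v \<bullet> e}) + (if s1 \<le> s then measure lborel M else 0))
    \<le> measure lborel (body 1 1 \<inter> {v. s < v \<bullet> e})"
proof -
  have [measurable]: "M \<in> sets borel"
  proof -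
    have [measurable]: "(\<lambda>v. norm (rest v)) \<in> borel_measurable borel"
      by (intro borel_measurable_continuous_onI continuous_intros)
    show ?thesis unfolding M_def by measurable
  qed
  \<comment> \<open>A contraction by \<open>1 - s\<close> towards \<open>e\<close> in every
    coordinate except the one along \<open>f\<close>.\<close>
  let ?T = "\<lambda>v. s *\<^sub>R e + ((1 - s) * (v \<bullet> e)) *\<^sub>R e + (1 * (v \<bullet> f)) *\<^sub>R f + (1 - s) *\<^sub>R rest v"
  let ?K = "body 1 1 \<inter> {v. 0 < v \<bullet> e}"
  let ?Q = "{v. ?T v \<in> body 1 1 \<inter> {v. s < v \<bullet> e}}"
  have [measurable]: "body 1 1 \<inter> {v. s < v \<bullet> e} \<in> sets borel" by measurable
  \<comment> \<open>One factor \<open>1 - s\<close> comes from \<open>e\<close> and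
    \<open>DIM('a) - 2\<close> factors come from \<open>rest\<close>; the truncated subtraction is
    harmless because two distinct basis vectors force dimension at least 2.\<close>
  have card: "DIM('a) - 1 = Suc (DIM('a) - 2)"
  proof -
    have "card {e, f} \<le> DIM('a)" using eB fB by (intro card_mono) auto
    then show ?thesis using ef by simp
  qed
  have stretch: "measure lborel (body 1 1 \<inter> {v. s < v \<bullet> e}) = (1 - s) ^ (DIM('a) - 1) * measure lborel ?Q"
    unfolding card using measure_lborel_stretch[of "1 - s" 1 "1 - s" "body 1 1 \<inter> {v. s < v \<bullet> e}" "s *\<^sub>R e"] s
    by simp
  \<comment> \<open>In the preimage the factor \<open>1 - s\<close> cancels from the condition along
    \<open>e\<close> but weakens the one along \<open>f\<close>; this makes room for
    \<open>M\<close>.\<close>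
  have Q: "?Q = {v. 0 < v \<bullet> e \<and> v \<bullet> e + norm (rest v) \<le> 1 \<and> \<bar>v \<bullet> f\<bar> + (1 - s) * norm (rest v) \<le> 1}"
  proof (intro set_eqI, unfold mem_Collect_eq)
    fix v
    have "s < s + (1 - s) * (v \<bullet> e) \<longleftrightarrow> 0 < v \<bullet> e" using s by (simp add: zero_less_mult_iff)
    moreover have "\<bar>s + (1 - s) * (v \<bullet> e)\<bar> + (1 - s) * norm (rest v) \<le> 1 \<longleftrightarrow> v \<bullet> e + norm (rest v) \<le> 1"
      if "0 < v \<bullet> e"
    proof -
      have "0 \<le> (1 - s) * (v \<bullet> e)" using s that by simp
      then have "\<bar>s + (1 - s) * (v \<bullet> e)\<bar> + (1 - s) * norm (rest v) \<le> 1
          \<longleftrightarrow> (1 - s) * (v \<bullet> e + norm (rest v)) \<le> (1 - s) * 1"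
        using s by (simp add: algebra_simps)
      then show ?thesis using s by (simp only: mult_le_cancel_left_pos)
    qed
    ultimately show "?T v \<in> body 1 1 \<inter> {v. s < v \<bullet> e} \<longleftrightarrow>
        0 < v \<bullet> e \<and> v \<bullet> e + norm (rest v) \<le> 1 \<and> \<bar>v \<bullet> f\<bar> + (1 - s) * norm (rest v) \<le> 1"
      using s by (auto simp: body_def rest_linear inner_add_left)
  qed
  have [measurable]: "?Q \<in> sets borel"
  proof -
    have [measurable]: "(\<lambda>v. norm (rest v)) \<in> borel_measurable borel"
      by (intro borel_measurable_continuous_onI continuous_intros)
    show ?thesis unfolding Q by measurable
  qed
  have bdd: "emeasure lborel S < \<infinity>" if "S \<subseteq> ?Q" for S
  proof (rule emeasure_bounded_finite)
    have "norm v \<le> 3" if "v \<in> ?Q" for v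
    proof -
      have *: "0 < v \<bullet> e" "v \<bullet> e + norm (rest v) \<le> 1" "\<bar>v \<bullet> f\<bar> + (1 - s) * norm (rest v) \<le> 1"
        using that unfolding Q by auto
      moreover have "0 \<le> (1 - s) * norm (rest v)" using s by simp
      ultimately show ?thesis using norm_le_coords[of v] by linarith
    qed
    with \<open>S \<subseteq> ?Q\<close> show "bounded S" by (auto simp: bounded_iff)
  qed
  have KQ: "?K \<subseteq> ?Q"
  proof
    fix v assume v: "v \<in> ?K"
    have "0 \<le> s * norm (rest v)" using s by simp
    then have "(1 - s) * norm (rest v) \<le> norm (rest v)" by (simp add: algebra_simps)
    with v show "v \<in> ?Q" unfolding Q by (auto simp: body_def)
  qed
  have Q_fm: "?Q \<in> fmeasurable lborel"
    by (rule fmeasurableI) (use bdd[OF order_refl] in \<open>simp_all only: sets_lborel, measurable\<close>)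
  have "measure lborel ?K + (if s1 \<le> s then measure lborel M else 0) \<le> measure lborel ?Q"
  proof (cases "s1 \<le> s")
    case True
    have MQ: "M \<subseteq> ?Q"
    proof
      fix v assume v: "v \<in> M"
      have "(1 - s) * norm (rest v) \<le> (1 - s1) * norm (rest v)"
        using True by (intro mult_right_mono) auto
      with v show "v \<in> ?Q" unfolding Q by (auto simp: M_def)
    qed
    have "measure lborel ?K + measure lborel M = measure lborel (?K \<union> M)"
    proof (rule measure_Union[symmetric])
      show "?K \<inter> M = {}" by (auto simp: body_def M_def)
      show "?K \<in> sets lborel" "M \<in> sets lborel" by measurable
    qed (use bdd[OF KQ] bdd[OF MQ] in auto)
    also have "\<dots> \<le> measure lborel ?Q"
      by (rule measure_mono_fmeasurable[OF _ _ Q_fm]) (use KQ MQ in \<open>blast, measurable\<close>)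
    finally show ?thesis using True by simp
  next
    case False
    then show ?thesis
      using measure_mono_fmeasurable[OF KQ _ Q_fm] by simp
  qed
  then show ?thesis unfolding stretch using s by (intro mult_left_mono) auto
qed

text \<open>\<open>measure_body_tail\<close> is divided by the volume \<open>a\<close> of half the
  body. The surplus from \<open>M\<close> is recorded only for \<open>s\<close> between
  \<open>1 / 4\<close> and \<open>1 / 2\<close>, where it has a constant lower bound.\<close>

lemma interior_law_tails:
  assumes dim: "3 \<le> DIM('a)"
  obtains \<kappa> where "0 < \<kappa>"
    "\<And>s. 0 \<le> s \<Longrightarrow> s < 1 \<Longrightarrow>
      (1 - s) ^ (DIM('a) - 1) + (if 1 / 4 \<le> s \<and> s < 1 / 2 then \<kappa> else 0) \<le> measure (interior_law 1 1) {s<..}"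
proof -
  define M where "M = {v. 0 < v \<bullet> e \<and> v \<bullet> e + norm (rest v) \<le> 1 \<and> 1 < \<bar>v \<bullet> f\<bar> + norm (rest v)
      \<and> \<bar>v \<bullet> f\<bar> + (1 - 1 / 4) * norm (rest v) \<le> 1}"
  define U where "U = {v. 0 < v \<bullet> e \<and> v \<bullet> e + norm (rest v) < 1 \<and> 1 < \<bar>v \<bullet> f\<bar> + norm (rest v)
      \<and> \<bar>v \<bullet> f\<bar> + (1 - 1 / 4) * norm (rest v) < 1}"
  define a where "a = measure lborel (body 1 1 \<inter> {v. 0 < v \<bullet> e})"
  have a: "measure lborel (body 1 1) = 2 * a" by (simp add: a_def measure_body_eq)
  have "0 < measure lborel (body 1 1)"
    using emeasure_body[of 1 1] by (simp add: measure_def enn2real_positive_iff zero_less_iff_neq_zero top.not_eq_extremum)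
  with a have apos: "0 < a" by simp
  have bounded: "bounded M"
  proof -
    have "norm v \<le> 3" if "v \<in> M" for v
    proof -
      have "0 < v \<bullet> e" "v \<bullet> e + norm (rest v) \<le> 1" "\<bar>v \<bullet> f\<bar> + (1 - 1 / 4) * norm (rest v) \<le> 1"
        using that unfolding M_def by auto
      moreover have "0 \<le> (1 - 1 / 4) * norm (rest v)" by simp
      ultimately show ?thesis using norm_le_coords[of v] by linarith
    qed
    then show ?thesis by (auto simp: bounded_iff)
  qed
  have UM: "U \<subseteq> M" by (auto simp: U_def M_def)
  \<comment> \<open>Here dimension 3 enters: without a third axis \<open>rest\<close> vanishes and
    \<open>M\<close> is empty.\<close>
  have "\<exists>g. g \<in> Basis - {e, f}"
  proof (rule ccontr)
    assume "\<nexists>g. g \<in> Basis - {e, f}"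
    then have "Basis \<subseteq> {e, f}" by auto
    then have "DIM('a) \<le> card {e, f}" by (intro card_mono) auto
    then show False using dim ef by simp
  qed
  then obtain g where g: "g \<in> Basis" "g \<noteq> e" "g \<noteq> f" by auto
  have g0: "g \<bullet> e = 0" "g \<bullet> f = 0" "norm g = 1" "rest g = g"
    using g eB fB by (auto simp: inner_Basis rest_def)
  \<comment> \<open>The sums to check are \<open>1/4 + 1/2 < 1\<close>, \<open>3/5 + 1/2 > 1\<close>
    and \<open>3/5 + 3/4 * 1/2 = 39/40 < 1\<close>.\<close>
  have "(1 / 4) *\<^sub>R e + (3 / 5) *\<^sub>R f + (1 / 2) *\<^sub>R g \<in> U"
    by (simp add: U_def rest_linear inner_add_left g0)
  then have "U \<noteq> {}" by blast
  moreover have "open U"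
    unfolding U_def by (intro open_Collect_conj open_Collect_less continuous_intros)
  ultimately have "0 < measure lborel U"
    using bounded_subset[OF bounded UM] by (intro measure_open_pos)
  moreover have "measure lborel U \<le> measure lborel M"
  proof (rule measure_mono_fmeasurable[OF UM])
    show "U \<in> sets lborel" using \<open>open U\<close> by auto
    have [measurable]: "(\<lambda>v. norm (rest v)) \<in> borel_measurable borel"
      by (intro borel_measurable_continuous_onI continuous_intros)
    have "M \<in> sets borel" unfolding M_def by measurable
    then show "M \<in> fmeasurable lborel"
      using emeasure_bounded_finite[OF bounded] by (auto simp: fmeasurable_def)
  qed
  ultimately have Mpos: "0 < measure lborel M" by simp
  \<comment> \<open>The power of \<open>1 / 2\<close> is a lower bound for that of
    \<open>1 - s\<close> when \<open>s < 1 / 2\<close>.\<close>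
  define \<kappa> where "\<kappa> = (1 / 2) ^ (DIM('a) - 1) * measure lborel M / a"
  show ?thesis
  proof (rule that)
    show "0 < \<kappa>" using Mpos apos by (simp add: \<kappa>_def)
    fix s :: real assume s: "0 \<le> s" "s < 1"
    let ?d = "if 1 / 4 \<le> s then measure lborel M else 0"
    have "measure (interior_law 1 1) {s<..} = measure lborel (body 1 1 \<inter> {v. s < v \<bullet> e}) / a"
      using measure_body_half[OF s(1)] by (simp add: measure_interior_law a)
    also have "\<dots> \<ge> (1 - s) ^ (DIM('a) - 1) * (a + ?d) / a"
      using measure_body_tail[of s "1 / 4"] s apos
      unfolding a_def[symmetric] M_def[symmetric] by (intro divide_right_mono) auto
    finally have 1: "(1 - s) ^ (DIM('a) - 1) * (a + ?d) / a \<le> measure (interior_law 1 1) {s<..}" .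
    have "(1 - s) ^ (DIM('a) - 1) * (a + ?d) / a = (1 - s) ^ (DIM('a) - 1) + (1 - s) ^ (DIM('a) - 1) * ?d / a"
      using apos by (simp add: field_simps)
    moreover have "(if 1 / 4 \<le> s \<and> s < 1 / 2 then \<kappa> else 0) \<le> (1 - s) ^ (DIM('a) - 1) * ?d / a"
    proof (cases "1 / 4 \<le> s \<and> s < 1 / 2")
      case True
      then have "(1 / 2) ^ (DIM('a) - 1) \<le> (1 - s) ^ (DIM('a) - 1)"
        by (intro power_mono) auto
      then show ?thesis
        using True Mpos apos by (auto simp: \<kappa>_def intro!: divide_right_mono mult_right_mono)
    next
      case False
      then show ?thesis using s apos by (auto intro!: divide_nonneg_pos mult_nonneg_nonneg)
    qed
    ultimately show "(1 - s) ^ (DIM('a) - 1) + (if 1 / 4 \<le> s \<and> s < 1 / 2 then \<kappa> else 0)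
        \<le> measure (interior_law 1 1) {s<..}"
      using 1 by linarith
  qed
qed

text \<open>This is the mass below \<open>s1 = 1 / 4\<close>, on which \<open>sym_energy_gap\<close>
  collects its gain. A ball of radius \<open>1 / 4\<close> fits because each of the three coordinate
  sizes is below \<open>1 / 4\<close> on it.\<close>

lemma interior_law_low: "0 < measure (interior_law 1 1) {..1/4}"
proof -
  have "0 < measure lborel (ball 0 (1 / 4) :: 'a set)"
    by (intro measure_open_pos) auto
  also have "\<dots> \<le> measure lborel (body 1 1 \<inter> {v. \<bar>v \<bullet> e\<bar> \<in> {..1/4}})"
  proof (rule measure_mono_fmeasurable)
    show "ball 0 (1 / 4) \<subseteq> body 1 1 \<inter> {v. \<bar>v \<bullet> e\<bar> \<in> {..1/4}}"
    proof
      fix v :: 'a assume "v \<in> ball 0 (1 / 4)"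
      then show "v \<in> body 1 1 \<inter> {v. \<bar>v \<bullet> e\<bar> \<in> {..1/4}}"
        using abs_inner_axes_le[of v] norm_rest_le[of v] by (simp add: body_def)
    qed
    have "emeasure lborel (body 1 1 \<inter> {v. \<bar>v \<bullet> e\<bar> \<in> {..1/4}}) < \<infinity>"
      by (intro emeasure_bounded_finite bounded_subset[OF compact_imp_bounded[OF compact_body]]) auto
    moreover have "body 1 1 \<inter> {v. \<bar>v \<bullet> e\<bar> \<in> {..1/4}} \<in> sets borel" by measurable
    ultimately show "body 1 1 \<inter> {v. \<bar>v \<bullet> e\<bar> \<in> {..1/4}} \<in> fmeasurable lborel"
      by (auto simp: fmeasurable_def)
  qed simp
  finally have "0 < measure lborel (body 1 1 \<inter> {v. \<bar>v \<bullet> e\<bar> \<in> {..1/4}})" .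
  moreover have "0 < measure lborel (body 1 1)"
    using emeasure_body[of 1 1] by (simp add: measure_def enn2real_positive_iff zero_less_iff_neq_zero top.not_eq_extremum)
  ultimately show ?thesis by (simp add: measure_interior_law)
qed

section \<open>Comparison\<close>

text \<open>Projection to the axis \<open>e\<close> does not increase distances, and on the body it
  decreases them by at most \<open>2 * b + 2 * c\<close>. The lower bound serves the interior, the
  upper one the boundary; there \<open>\<omega>\<close> bounds the increase of
  \<open>z powr p\<close> under such a shift.\<close>

lemma distance_moment_bounds:
  assumes b: "0 < b" and c: "0 < c" and p: "1 \<le> p"
    and U: "prob_space U" "sets U = sets borel" "AE v in U. v \<in> body b c"
    and sym: "distr U borel uminus = U"
  defines "L \<equiv> distr U borel (\<lambda>v. \<bar>v \<bullet> e\<bar>)"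
  shows "sym_energy p L \<le> distance_moment p U"
    and "(\<And>z. 0 \<le> z \<Longrightarrow> z \<le> 2 \<Longrightarrow> (z + (2 * b + 2 * c)) powr p \<le> z powr p + \<omega>) \<Longrightarrow>
      distance_moment p U \<le> sym_energy p L + \<omega>"
proof -
  interpret U: prob_space U by fact
  interpret pair_prob_space U U ..
  have [measurable_cong]: "sets U = sets borel" by fact
  have e1: "AE v in U. \<bar>v \<bullet> e\<bar> \<le> 1"
    using U(3) by eventually_elim (use body_coords(1)[OF _ b c] in blast)
  note lin = linear_moment_eq_sym_energy[OF U(1,2) e1 sym p, folded L_def]
  have AE2: "AE z in U \<Otimes>\<^sub>M U. fst z \<in> body b c \<and> snd z \<in> body b c"
    by (rule AE_pair_measure_conj[OF U(1,1,3,3)])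
  have upper: "dist x y \<le> \<bar>x \<bullet> e - y \<bullet> e\<bar> + (2 * b + 2 * c)" "\<bar>x \<bullet> e - y \<bullet> e\<bar> \<le> 2"
    if "x \<in> body b c" "y \<in> body b c" for x y
  proof -
    note X = body_coords[OF that(1) b c] and Y = body_coords[OF that(2) b c]
    have "norm (rest (x - y)) \<le> 2 * b"
      using norm_triangle_ineq4[of "rest x" "rest y"] X Y by (simp add: rest_diff)
    moreover have "\<bar>(x - y) \<bullet> f\<bar> \<le> 2 * c"
      using X Y by (simp add: inner_diff_left)
    ultimately show "dist x y \<le> \<bar>x \<bullet> e - y \<bullet> e\<bar> + (2 * b + 2 * c)"
      using norm_le_coords[of "x - y"] by (simp add: dist_norm inner_diff_left)
    show "\<bar>x \<bullet> e - y \<bullet> e\<bar> \<le> 2" using X Y by linarith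
  qed
  have lower: "\<bar>x \<bullet> e - y \<bullet> e\<bar> \<le> dist x y" for x y
    using abs_inner_axes_le(1)[of "x - y"] by (simp add: dist_norm inner_diff_left)
  have int: "integrable (U \<Otimes>\<^sub>M U) (\<lambda>(x, y). dist x y powr p)"
  proof (rule integrable_const_bound)
    show "AE z in U \<Otimes>\<^sub>M U. norm (case z of (x, y) \<Rightarrow> dist x y powr p) \<le> (2 + (2 * b + 2 * c)) powr p"
      using AE2
    proof eventually_elim
      case (elim z)
      then have "dist (fst z) (snd z) \<le> 2 + (2 * b + 2 * c)"
        using upper[of "fst z" "snd z"] by linarith
      then have "dist (fst z) (snd z) powr p \<le> (2 + (2 * b + 2 * c)) powr p"
        using p by (intro powr_mono2) auto
      then show ?case by (simp add: case_prod_beta)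
    qed
  qed measurable
  show "sym_energy p L \<le> distance_moment p U"
    unfolding lin(2)[symmetric] distance_moment_def
    by (rule integral_mono[OF lin(1) int]) (use p lower in \<open>auto intro!: powr_mono2\<close>)
  show "distance_moment p U \<le> sym_energy p L + \<omega>"
    if \<omega>: "\<And>z. 0 \<le> z \<Longrightarrow> z \<le> 2 \<Longrightarrow> (z + (2 * b + 2 * c)) powr p \<le> z powr p + \<omega>"
  proof -
    have "distance_moment p U \<le> (\<integral>z. (case z of (x, y) \<Rightarrow> \<bar>x \<bullet> e - y \<bullet> e\<bar> powr p) + \<omega> \<partial>(U \<Otimes>\<^sub>M U))"
      unfolding distance_moment_def
    proof (rule integral_mono_AE[OF int])
      show "integrable (U \<Otimes>\<^sub>M U) (\<lambda>z. (case z of (x, y) \<Rightarrow> \<bar>x \<bullet> e - y \<bullet> e\<bar> powr p) + \<omega>)"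
        using lin(1) by (rule Bochner_Integration.integrable_add) simp
      show "AE z in U \<Otimes>\<^sub>M U. (case z of (x, y) \<Rightarrow> dist x y powr p)
          \<le> (case z of (x, y) \<Rightarrow> \<bar>x \<bullet> e - y \<bullet> e\<bar> powr p) + \<omega>"
        using AE2
      proof eventually_elim
        case (elim z)
        then have "dist (fst z) (snd z) powr p \<le> (\<bar>fst z \<bullet> e - snd z \<bullet> e\<bar> + (2 * b + 2 * c)) powr p"
          using upper(1)[of "fst z" "snd z"] p by (intro powr_mono2) auto
        also have "\<dots> \<le> \<bar>fst z \<bullet> e - snd z \<bullet> e\<bar> powr p + \<omega>"
          using upper(2)[of "fst z" "snd z"] elim by (intro \<omega>) auto
        finally show ?case by (simp add: case_prod_beta)
      qed
    qed
    also have "\<dots> = sym_energy p L + \<omega>"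
      by (subst Bochner_Integration.integral_add[OF lin(1)]) (simp_all add: lin(2) prob_space)
    finally show ?thesis .
  qed
qed

text \<open>The wide facets supply \<open>(1 - s) ^ k\<close>. Since \<open>N\<close> times the
  measure of the thin facets is at most \<open>\<epsilon> * N\<close> times that of the wide ones,
  the thin facets add at most \<open>\<epsilon>\<close>.\<close>

lemma boundary_law_tail:
  fixes N k :: nat
  assumes b: "0 < b" and c: "0 < c" and N: "0 < N" "3 * c * real N \<le> 1"
    and \<epsilon>: "2 * (2 * (2 + 1 / b)) ^ k \<le> \<epsilon> * real N"
    and fin: "emeasure (hausdorff_measure k) (frontier (body b c)) \<noteq> 0"
      "emeasure (hausdorff_measure k) (frontier (body b c)) \<noteq> \<infinity>"
    and s: "0 \<le> s" "s < 1"
  shows "measure (distr (uniform_measure (hausdorff_measure k) (frontier (body b c))) borel (\<lambda>v. \<bar>v \<bullet> e\<bar>)) {s<..}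
    \<le> (1 - s) ^ k + \<epsilon>"
proof -
  let ?H = "hausdorff_measure k :: 'a measure" and ?F = "frontier (body b c)"
  let ?W = "wide_facets b c" and ?T = "thin_facets b c" and ?X = "{v. s < \<bar>v \<bullet> e\<bar>}"
  have F: "?F = ?W \<union> ?T" by (rule frontier_body[OF b c])
  have [measurable]: "?F \<in> sets borel" unfolding F by measurable
  have X [measurable]: "?X \<in> sets borel" by measurable
  \<comment> \<open>Finiteness of the frontier measure allows the estimates to pass from
    \<open>ennreal\<close> to the reals.\<close>
  have em: "emeasure ?H A = ennreal (measure ?H A)" if "A \<subseteq> ?F" for A
  proof (rule emeasure_eq_ennreal_measure)
    have "emeasure ?H A \<le> emeasure ?H ?F" using that by (intro emeasure_mono) auto
    then show "emeasure ?H A \<noteq> top" using fin(2) by (auto simp: top_unique)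
  qed
  have em_parts: "emeasure ?H ?W = ennreal (measure ?H ?W)" "emeasure ?H ?T = ennreal (measure ?H ?T)"
      "emeasure ?H ?F = ennreal (measure ?H ?F)" "emeasure ?H (?W \<inter> ?X) = ennreal (measure ?H (?W \<inter> ?X))"
      "emeasure ?H (?F \<inter> ?X) = ennreal (measure ?H (?F \<inter> ?X))"
    by (rule em, use F in blast)+
  have pos: "0 < measure ?H ?F"
    using fin em[OF order_refl] by (simp add: zero_less_measure_iff)
  have 1: "measure ?H (?W \<inter> ?X) \<le> (1 - s) ^ k * measure ?H ?W"
  proof -
    have "ennreal (measure ?H (?W \<inter> ?X)) \<le> ennreal ((1 - s) ^ k) * ennreal (measure ?H ?W)"
      using emeasure_wide_facets_tail[OF b c s, of k] unfolding em_parts .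
    then show ?thesis using s by (subst (asm) ennreal_mult[symmetric]) (auto simp: ennreal_le_iff)
  qed
  have 2: "real N * measure ?H ?T \<le> 2 * (2 * (2 + 1 / b)) ^ k * measure ?H ?W"
  proof -
    have "of_nat N * ennreal (measure ?H ?T) \<le> ennreal (2 * (2 * (2 + 1 / b)) ^ k) * ennreal (measure ?H ?W)"
      using emeasure_thin_facets_le[OF b c N(2), of k] unfolding em_parts .
    moreover have "of_nat N = ennreal (real N)" by (rule ennreal_of_nat_eq_real_of_nat)
    moreover have "0 \<le> 2 * (2 * (2 + 1 / b)) ^ k" using b by simp
    ultimately have "ennreal (real N * measure ?H ?T) \<le> ennreal (2 * (2 * (2 + 1 / b)) ^ k * measure ?H ?W)"
      by (simp only:) (simp only: ennreal_mult measure_nonneg of_nat_0_le_iff)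
    then show ?thesis using b by (subst (asm) ennreal_le_iff) auto
  qed
  have 3: "measure ?H ?W \<le> measure ?H ?F"
  proof -
    have "emeasure ?H ?W \<le> emeasure ?H ?F" using F by (intro emeasure_mono) auto
    then show ?thesis unfolding em_parts by simp
  qed
  have "real N * measure ?H ?T \<le> (\<epsilon> * real N) * measure ?H ?W"
    using 2 mult_right_mono[OF \<epsilon>, of "measure ?H ?W"] by simp
  then have "real N * measure ?H ?T \<le> real N * (\<epsilon> * measure ?H ?W)" by (simp add: mult_ac)
  then have T: "measure ?H ?T \<le> \<epsilon> * measure ?H ?W" using N by simp
  have "0 < \<epsilon> * real N" using \<epsilon> b by (intro less_le_trans[OF _ \<epsilon>]) (auto intro!: mult_pos_pos zero_less_power add_pos_pos)
  then have \<epsilon>0: "0 < \<epsilon>" using N by (simp add: zero_less_mult_iff)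
  have sub: "measure ?H (?F \<inter> ?X) \<le> measure ?H (?W \<inter> ?X) + measure ?H ?T"
  proof -
    have "emeasure ?H (?F \<inter> ?X) \<le> emeasure ?H ((?W \<inter> ?X) \<union> ?T)" using F by (intro emeasure_mono) auto
    also have "\<dots> \<le> emeasure ?H (?W \<inter> ?X) + emeasure ?H ?T" by (rule emeasure_subadditive) auto
    finally have "ennreal (measure ?H (?F \<inter> ?X)) \<le> ennreal (measure ?H (?W \<inter> ?X) + measure ?H ?T)"
      unfolding em_parts by simp
    then show ?thesis by (subst (asm) ennreal_le_iff) auto
  qed
  have "measure ?H (?F \<inter> ?X) \<le> ((1 - s) ^ k + \<epsilon>) * measure ?H ?W"
    using sub 1 T by (simp add: distrib_right)
  also have "\<dots> \<le> ((1 - s) ^ k + \<epsilon>) * measure ?H ?F"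
    using 3 s \<epsilon>0 by (intro mult_left_mono) auto
  finally have le: "measure ?H (?F \<inter> ?X) / measure ?H ?F \<le> (1 - s) ^ k + \<epsilon>"
    using pos by (simp add: pos_divide_le_eq)
  have "measure (distr (uniform_measure ?H ?F) borel (\<lambda>v. \<bar>v \<bullet> e\<bar>)) {s<..} = measure (uniform_measure ?H ?F) ?X"
    by (subst measure_distr) (auto simp: vimage_def)
  also have "\<dots> = measure ?H (?F \<inter> ?X) / measure ?H ?F"
    using fin by (intro measure_uniform_measure) auto
  finally show ?thesis using le by simp
qed

text \<open>The gain \<open>\<gamma>\<close> depends only on the interior law, hence not on
  \<open>b\<close> and \<open>c\<close>. The thin facets and the thickness of the body then cost at
  most \<open>\<gamma> / 4\<close> each, which leaves a strict inequality.\<close>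

lemma exists_body_interior_gt_boundary:
  assumes dim: "3 \<le> DIM('a)" and p: "1 \<le> p"
  shows "\<exists>b>0. \<exists>c>0. boundary_moment p (body b c) < interior_moment p (body b c)"
proof -
  let ?k = "DIM('a) - 1" and ?\<mu> = "interior_law 1 1"
  obtain \<kappa> where \<kappa>: "0 < \<kappa>" and tails: "\<And>s. 0 \<le> s \<Longrightarrow> s < 1 \<Longrightarrow>
      (1 - s) ^ ?k + (if 1 / 4 \<le> s \<and> s < 1 / 2 then \<kappa> else 0) \<le> measure ?\<mu> {s<..}"
    using interior_law_tails[OF dim] by blast
  have \<mu>: "prob_space ?\<mu>" "sets ?\<mu> = sets borel" "AE x in ?\<mu>. 0 \<le> x \<and> x \<le> 1"
    using prob_space_interior_law AE_interior_law by auto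
  define \<gamma> where "\<gamma> = \<kappa> * ((1 / 4) powr p / 2) * measure ?\<mu> {..1/4}"
  have \<gamma>: "0 < \<gamma>" using \<kappa> interior_law_low by (simp add: \<gamma>_def)
  have gap: "sym_energy p \<nu> + \<gamma> \<le> sym_energy p ?\<mu> + 2 * \<epsilon> * 2 powr p"
    if "prob_space \<nu>" "sets \<nu> = sets borel" "AE x in \<nu>. 0 \<le> x \<and> x \<le> 1" "0 \<le> \<epsilon>"
      "\<And>s. 0 \<le> s \<Longrightarrow> s < 1 \<Longrightarrow> measure \<nu> {s<..} \<le> (1 - s) ^ ?k + \<epsilon>" for \<nu> \<epsilon>
  proof -
    have "sym_energy p \<nu> + \<kappa> * ((1 / 2 - 1 / 4) powr p / 2) * measure ?\<mu> {..1/4}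
        \<le> sym_energy p ?\<mu> + 2 * \<epsilon> * 2 powr p"
    proof (rule sym_energy_gap[OF that(1-3) \<mu>])
      fix s :: real assume "0 \<le> s" "s < 1"
      then show "measure \<nu> {s<..} + (if 1 / 4 \<le> s \<and> s < 1 / 2 then \<kappa> else 0) \<le> measure ?\<mu> {s<..} + \<epsilon>"
        using tails[of s] that(5)[of s] by linarith
    qed (use \<kappa> p that(4) in auto)
    then show ?thesis by (simp add: \<gamma>_def)
  qed
  \<comment> \<open>Comparison with the point mass at 0, whose tails vanish. Positivity settles the
    case in which the boundary moment is 0 because the frontier has measure 0 or
    \<open>\<infinity>\<close>.\<close>
  have pos: "0 < sym_energy p ?\<mu>"
  proof -
    let ?\<delta> = "return borel (0 :: real)"
    have "measure ?\<delta> {s<..} = 0" if "0 \<le> s" for s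
      using that by (simp add: measure_return)
    then have "sym_energy p ?\<delta> + \<gamma> \<le> sym_energy p ?\<mu> + 2 * 0 * 2 powr p"
      by (intro gap) (auto simp: prob_space_return AE_return)
    moreover have "0 \<le> sym_energy p ?\<delta>"
      unfolding sym_energy_def by (intro integral_nonneg_AE AE_I2 sym_moment_nonneg)
    ultimately show ?thesis using \<gamma> by simp
  qed
  define \<epsilon> where "\<epsilon> = \<gamma> / (8 * 2 powr p)"
  have \<epsilon>: "0 < \<epsilon>" "2 * \<epsilon> * 2 powr p = \<gamma> / 4" using \<gamma> by (auto simp: \<epsilon>_def)
  \<comment> \<open>The interval contains \<open>z + (2 * b + 2 * c)\<close> for
    \<open>z \<le> 2\<close>, as \<open>c \<le> b\<close> and \<open>4 * b \<le> 1\<close>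
    below.\<close>
  have "uniformly_continuous_on {0..3} (\<lambda>z. z powr p :: real)"
    using p by (intro compact_uniformly_continuous continuous_on_powr' continuous_intros) auto
  then obtain \<delta> where \<delta>: "0 < \<delta>" "\<And>x y. x \<in> {0..3} \<Longrightarrow> y \<in> {0..3} \<Longrightarrow> dist y x < \<delta> \<Longrightarrow>
      dist (y powr p) (x powr p) < \<gamma> / 4"
    unfolding uniformly_continuous_on_def using \<gamma> by (metis divide_pos_pos zero_less_numeral)
  define b where "b = min \<delta> 1 / 8"
  have b: "0 < b" "4 * b < \<delta>" "4 * b \<le> 1" using \<delta>(1) by (auto simp: b_def min_def)
  \<comment> \<open>\<open>N\<close> comes after \<open>b\<close>, because the Lipschitz constant
    for the thin facets contains \<open>1 / b\<close>, and before \<open>c\<close>, which has to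
    leave room for \<open>N\<close> translates.\<close>
  define N where "N = Suc (nat \<lceil>2 * (2 * (2 + 1 / b)) ^ ?k / \<epsilon>\<rceil>)"
  have N: "0 < N" by (simp add: N_def)
  have "2 * (2 * (2 + 1 / b)) ^ ?k / \<epsilon> \<le> real N"
    unfolding N_def by linarith
  then have N\<epsilon>: "2 * (2 * (2 + 1 / b)) ^ ?k \<le> \<epsilon> * real N"
    using \<epsilon>(1) by (simp add: pos_divide_le_eq mult.commute)
  define c where "c = min b (1 / (3 * real N))"
  have c: "0 < c" "c \<le> b" using b N by (auto simp: c_def)
  have "c \<le> 1 / (3 * real N)" by (simp add: c_def)
  then have cN: "3 * c * real N \<le> 1" using N by (simp add: pos_le_divide_eq mult_ac)
  have \<omega>: "(z + (2 * b + 2 * c)) powr p \<le> z powr p + \<gamma> / 4" if "0 \<le> z" "z \<le> 2" for z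
  proof -
    have "dist ((z + (2 * b + 2 * c)) powr p) (z powr p) < \<gamma> / 4"
      using that b c by (intro \<delta>(2)) (auto simp: dist_real_def)
    then show ?thesis unfolding dist_real_def by linarith
  qed
  let ?K = "body b c"
  let ?U = "uniform_measure lborel ?K"
  have "sym_energy p ?\<mu> \<le> interior_moment p ?K"
  proof -
    have "sym_energy p (distr ?U borel (\<lambda>v. \<bar>v \<bullet> e\<bar>)) \<le> distance_moment p ?U"
    proof (rule distance_moment_bounds(1)[OF b(1) c(1) p])
      show "prob_space ?U" by (rule prob_space_uniform_body[OF b(1) c(1)])
      show "AE v in ?U. v \<in> ?K" by (rule AE_uniform_measureI) auto
      show "distr ?U borel uminus = ?U"
        by (rule distr_uminus_uniform_measure) (auto intro: emeasure_lborel_uminus)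
    qed simp
    then show ?thesis
      using interior_law_eq[OF b(1) c(1)] by (simp add: interior_law_def interior_moment_def)
  qed
  moreover have "boundary_moment p ?K < sym_energy p ?\<mu>"
  proof -
    let ?H = "hausdorff_measure ?k :: 'a measure" and ?F = "frontier ?K"
    let ?V = "uniform_measure ?H ?F"
    have F [measurable]: "?F \<in> sets borel" by (simp add: borel_closed)
    have bm: "boundary_moment p ?K = distance_moment p ?V" by (simp add: boundary_moment_def)
    show ?thesis
    proof (cases "emeasure ?H ?F = 0 \<or> emeasure ?H ?F = \<infinity>")
      case True
      then show ?thesis
        using distance_moment_uniform_degenerate[OF sets_hausdorff_measure F] pos bm by simp
    next
      case False
      then have fin: "emeasure ?H ?F \<noteq> 0" "emeasure ?H ?F \<noteq> \<infinity>" by auto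
      let ?\<nu> = "distr ?V borel (\<lambda>v. \<bar>v \<bullet> e\<bar>)"
      have V: "prob_space ?V" by (rule prob_space_uniform_measure[OF fin])
      have FK: "?F \<subseteq> ?K" using closed_body by (rule frontier_subset_closed)
      then have AE: "AE v in ?V. v \<in> ?K" by (intro AE_uniform_measureI) auto
      have Fsym: "uminus -` ?F = ?F"
        unfolding frontier_body[OF b(1) c(1)] by (auto simp: wide_facets_def thin_facets_def rest_minus)
      have "distance_moment p ?V \<le> sym_energy p ?\<nu> + \<gamma> / 4"
      proof (rule distance_moment_bounds(2)[OF b(1) c(1) p V _ AE _ \<omega>])
        show "distr ?V borel uminus = ?V"
          by (rule distr_uminus_uniform_measure) (auto intro: emeasure_hausdorff_measure_uminus simp: Fsym)
      qed simp_all
      moreover have "sym_energy p ?\<nu> + \<gamma> \<le> sym_energy p ?\<mu> + 2 * \<epsilon> * 2 powr p"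
      proof (rule gap)
        show "prob_space ?\<nu>" using V by (intro prob_space.prob_space_distr) auto
        have "AE v in ?V. 0 \<le> \<bar>v \<bullet> e\<bar> \<and> \<bar>v \<bullet> e\<bar> \<le> 1"
          using AE by eventually_elim (use body_coords(1)[OF _ b(1) c(1)] in simp)
        then show "AE x in ?\<nu>. 0 \<le> x \<and> x \<le> 1" by (subst AE_distr_iff) auto
        show "measure ?\<nu> {s<..} \<le> (1 - s) ^ ?k + \<epsilon>" if "0 \<le> s" "s < 1" for s
          by (rule boundary_law_tail[OF b(1) c(1) N cN N\<epsilon> fin that])
      qed (use \<epsilon> in auto)
      ultimately show ?thesis using bm \<epsilon> \<gamma> by linarith
    qed
  qed
  ultimately show ?thesis using b(1) c(1) by (intro exI[of _ b] exI[of _ c] conjI) auto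
qed

end

theorem theorem2:
  fixes p :: real
  assumes "CARD('n::finite) \<ge> 3" and "p \<ge> 1"
  shows "\<exists>K :: (real ^ 'n) set. convex_body K \<and> centrally_symmetric K \<and>
           interior_moment p K > boundary_moment p K"
proof -
  have dim: "3 \<le> DIM(real ^ 'n)" using assms(1) by simp
  then obtain e :: "real ^ 'n" where e: "e \<in> Basis" by fastforce
  have "\<not> Basis \<subseteq> {e}"
    using card_mono[of "{e}" "Basis :: (real ^ 'n) set"] dim by auto
  then obtain f where f: "f \<in> Basis" "e \<noteq> f" by auto
  interpret two_axes e f using e f by unfold_locales
  obtain b c where "0 < b" "0 < c" "boundary_moment p (body b c) < interior_moment p (body b c)"
    using exists_body_interior_gt_boundary[OF dim assms(2)] by blast
  then show ?thesis
    using convex_body_body centrally_symmetric_body by (intro exI[of _ "body b c"]) auto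
qed

end
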